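(* In neutral constructive geometry (with intuitionistic logic), the strong parallel postulate implies Euclid's Postulate 5.
   Context: Logic is intuitionistic. Neutral constructive geometry means constructive plane geometry without any parallel postulate. Primitives: points, strict betweenness $B(a,b,c)$, segment congruence $ab=cd$; $T(a,b,c)$ abbreviates $\neg(a\neq b\wedge b\neq c\wedge\neg B(a,b,c))$. For $a\neq b$, a point $x$ lies on $\mathrm{Line}(a,b)$ iff $\neg\neg(B(a,b,x)\vee B(b,x,a)\vee B(x,a,b)\vee x=a\vee x=b)$; every line is given by two distinct points. Points are collinear if they lie on a common line. A circle is given by a center and a radius segment (possibly null). $ab\le cd$ means $\exists e\,(T(c,e,d)\wedge ab=ce)$. No particular axiomatization is prescribed; the principles used are: (1) Stability: $\neg\neg A\to A$ for $A$ an equality, betweenness or congruence. (2) $ab=ba$; $ab=pq\wedge ab=rs\to pq=rs$; $ab=cc\to a=b$. (3) Extension: if $a\neq b$ then for all $c,d$ there is $x$ with $T(a,b,x)$ and $bx=cd$. (4) Five-segment axiom: if $a\neq b$, $T(a,b,c)$, $T(a',b',c')$, $ab=a'b'$, $bc=b'c'$, $ad=a'd'$, $bd=b'd'$ then $cd=c'd'$. (5) $B(a,b,c)$ implies $B(c,b,a)$, $a\ne b$, $b\neq c$; $\neg B(a,b,a)$; $T(a,b,d)\wedge T(b,c,d)\to T(a,b,c)\wedge T(a,c,d)$; $T(a,b,c)\wedge T(b,c,d)\wedge b\neq c\to T(a,c,d)\wedge T(a,b,d)$; $B(a,b,c)\wedge B(a,b,d)\wedge\neg T(a,c,d)\to T(a,d,c)$.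 (6) Inner Pasch: if $a,b,c$ are not collinear, $B(a,p,c)$ and $B(b,q,c)$, there is $x$ with $B(p,x,b)$ and $B(q,x,a)$. (7) There are three non-collinear points; any three points each equidistant from two given distinct points are collinear. (8) Line-circle continuity: if $a\ne b$, $a$ is non-strictly inside a circle and $b$ non-strictly outside it, then the circle contains a point $x$ with $T(a,x,b)$. Circle-circle continuity: if two circles have distinct centers and the first has a point non-strictly inside and a point non-strictly outside the second, they have a common point. Strong parallel postulate: for all points $p,q,r,s,t,a$, if $B(p,t,q)$, $B(s,t,r)$, $pt=qt$, $rt=st$, $p\neq r$, $p$ is not on $\mathrm{Line}(s,q)$, and $a$ is not on $\mathrm{Line}(p,r)$, then there is a point on both $\mathrm{Line}(s,q)$ and $\mathrm{Line}(p,a)$. Euclid 5: for all points $p,q,r,s,t,a$, if $B(q,a,r)$, $B(p,t,q)$, $B(s,t,r)$, $pt=qt$, $rt=st$, $p\neq r$, and $p$ is not on $\mathrm{Line}(s,q)$, then there is a point $x$ on both $\mathrm{Line}(s,q)$ and $\mathrm{Line}(p,a)$ with $B(p,a,x)$ and $B(s,q,x)$. *)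

theory Defs
  imports Main
begin

text \<open>Isabelle/HOL is classical, so the object logic is embedded deeply: first-order formulas over
  points, with an inductively defined intuitionistic natural deduction relation. The language has
  no function symbols, so terms are variables, represented by de Bruijn indices.\<close>

datatype fm =
    Eq nat nat
  | Btw nat nat nat
  | Cng nat nat nat nat
  | Bot
  | And fm fm
  | Or fm fm
  | Imp fm fm
  | All fm
  | Ex fm

text \<open>Renaming of free variables. Since all terms are variables, it subsumes substitution.\<close>

primrec ren :: "(nat \<Rightarrow> nat) \<Rightarrow> fm \<Rightarrow> fm" where
  "ren f (Eq a b) = Eq (f a) (f b)"
| "ren f (Btw a b c) = Btw (f a) (f b) (f c)"
| "ren f (Cng a b c d) = Cng (f a) (f b) (f c) (f d)"
| "ren f Bot = Bot"
| "ren f (And p q) = And (ren f p) (ren f q)"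
| "ren f (Or p q) = Or (ren f p) (ren f q)"
| "ren f (Imp p q) = Imp (ren f p) (ren f q)"
| "ren f (All p) = All (ren (case_nat 0 (\<lambda>n. Suc (f n))) p)"
| "ren f (Ex p) = Ex (ren (case_nat 0 (\<lambda>n. Suc (f n))) p)"

definition lift :: "fm \<Rightarrow> fm" where
  "lift = ren Suc"

definition inst :: "fm \<Rightarrow> nat \<Rightarrow> fm" where
  "inst p t = ren (case_nat t (\<lambda>n. n)) p"

text \<open>In the rules \<open>AllI\<close> and \<open>ExE\<close> lifting the context makes variable 0 fresh (the eigenvariable
  condition).\<close>

inductive deriv :: "fm set \<Rightarrow> fm \<Rightarrow> bool" (infix \<open>\<turnstile>\<close> 20) where
  Assm: "p \<in> \<Gamma> \<Longrightarrow> \<Gamma> \<turnstile> p"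
| BotE: "\<Gamma> \<turnstile> Bot \<Longrightarrow> \<Gamma> \<turnstile> p"
| AndI: "\<Gamma> \<turnstile> p \<Longrightarrow> \<Gamma> \<turnstile> q \<Longrightarrow> \<Gamma> \<turnstile> And p q"
| AndE1: "\<Gamma> \<turnstile> And p q \<Longrightarrow> \<Gamma> \<turnstile> p"
| AndE2: "\<Gamma> \<turnstile> And p q \<Longrightarrow> \<Gamma> \<turnstile> q"
| OrI1: "\<Gamma> \<turnstile> p \<Longrightarrow> \<Gamma> \<turnstile> Or p q"
| OrI2: "\<Gamma> \<turnstile> q \<Longrightarrow> \<Gamma> \<turnstile> Or p q"
| OrE: "\<Gamma> \<turnstile> Or p q \<Longrightarrow> insert p \<Gamma> \<turnstile> r \<Longrightarrow> insert q \<Gamma> \<turnstile> r \<Longrightarrow> \<Gamma> \<turnstile> r"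
| ImpI: "insert p \<Gamma> \<turnstile> q \<Longrightarrow> \<Gamma> \<turnstile> Imp p q"
| ImpE: "\<Gamma> \<turnstile> Imp p q \<Longrightarrow> \<Gamma> \<turnstile> p \<Longrightarrow> \<Gamma> \<turnstile> q"
| AllI: "lift ` \<Gamma> \<turnstile> p \<Longrightarrow> \<Gamma> \<turnstile> All p"
| AllE: "\<Gamma> \<turnstile> All p \<Longrightarrow> \<Gamma> \<turnstile> inst p t"
| ExI: "\<Gamma> \<turnstile> inst p t \<Longrightarrow> \<Gamma> \<turnstile> Ex p"
| ExE: "\<Gamma> \<turnstile> Ex p \<Longrightarrow> insert p (lift ` \<Gamma>) \<turnstile> lift q \<Longrightarrow> \<Gamma> \<turnstile> q"
| EqI: "\<Gamma> \<turnstile> Eq t t"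
| EqE: "\<Gamma> \<turnstile> Eq s t \<Longrightarrow> \<Gamma> \<turnstile> inst p s \<Longrightarrow> \<Gamma> \<turnstile> inst p t"

text \<open>To write sentences with named variables, formulas are first given as functions of the number
  \<open>n\<close> of enclosing quantifiers, and points as de Bruijn \<^emph>\<open>levels\<close>: the variable bound by a quantifier
  at depth \<open>k\<close> is \<open>k\<close>, and occurs at depth \<open>n\<close> as the index \<open>n - Suc k\<close>. A sentence is obtained at
  depth 0. All bold connectives produce ordinary de Bruijn formulas.\<close>

type_synonym lfm = "nat \<Rightarrow> fm"

definition sentence :: "lfm \<Rightarrow> fm" where
  "sentence P = P 0"

definition all :: "(nat \<Rightarrow> lfm) \<Rightarrow> lfm" (binder \<open>\<^bold>\<forall>\<close> 10) where
  "all P = (\<lambda>n. All (P n (Suc n)))"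

definition ex :: "(nat \<Rightarrow> lfm) \<Rightarrow> lfm" (binder \<open>\<^bold>\<exists>\<close> 10) where
  "ex P = (\<lambda>n. Ex (P n (Suc n)))"

definition imp :: "lfm \<Rightarrow> lfm \<Rightarrow> lfm" (infixr \<open>\<^bold>\<longrightarrow>\<close> 25) where
  "(P \<^bold>\<longrightarrow> Q) = (\<lambda>n. Imp (P n) (Q n))"

definition disj :: "lfm \<Rightarrow> lfm \<Rightarrow> lfm" (infixr \<open>\<^bold>\<or>\<close> 30) where
  "(P \<^bold>\<or> Q) = (\<lambda>n. Or (P n) (Q n))"

definition conj :: "lfm \<Rightarrow> lfm \<Rightarrow> lfm" (infixr \<open>\<^bold>\<and>\<close> 35) where
  "(P \<^bold>\<and> Q) = (\<lambda>n. And (P n) (Q n))"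

definition neg :: "lfm \<Rightarrow> lfm" (\<open>\<^bold>\<not> _\<close> [40] 40) where
  "(\<^bold>\<not> P) = (\<lambda>n. Imp (P n) Bot)"

definition eq :: "nat \<Rightarrow> nat \<Rightarrow> lfm" (infix \<open>\<^bold>=\<close> 50) where
  "(a \<^bold>= b) = (\<lambda>n. Eq (n - Suc a) (n - Suc b))"

abbreviation neq :: "nat \<Rightarrow> nat \<Rightarrow> lfm" (infix \<open>\<^bold>\<noteq>\<close> 50) where
  "a \<^bold>\<noteq> b \<equiv> \<^bold>\<not> a \<^bold>= b"

definition btw :: "nat \<Rightarrow> nat \<Rightarrow> nat \<Rightarrow> lfm" (\<open>\<^bold>B\<close>) where
  "\<^bold>B a b c = (\<lambda>n. Btw (n - Suc a) (n - Suc b) (n - Suc c))"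

definition cng :: "nat \<Rightarrow> nat \<Rightarrow> nat \<Rightarrow> nat \<Rightarrow> lfm" (\<open>_\<^bold>\<cdot>_ \<^bold>\<cong> _\<^bold>\<cdot>_\<close> [60, 60, 60, 60] 50) where
  "(a\<^bold>\<cdot>b \<^bold>\<cong> c\<^bold>\<cdot>d) = (\<lambda>n. Cng (n - Suc a) (n - Suc b) (n - Suc c) (n - Suc d))"

text \<open>Non-strict betweenness.\<close>

definition btw_T :: "nat \<Rightarrow> nat \<Rightarrow> nat \<Rightarrow> lfm" (\<open>\<^bold>T\<close>) where
  "\<^bold>T a b c = (\<^bold>\<not> (a \<^bold>\<noteq> b \<^bold>\<and> b \<^bold>\<noteq> c \<^bold>\<and> \<^bold>\<not> \<^bold>B a b c))"

text \<open>\<open>on_line x a b\<close>: \<open>x\<close> lies on the line through \<open>a\<close> and \<open>b\<close>; only meaningful for distinct \<open>a\<close>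
  and \<open>b\<close>, which is not part of the formula.\<close>

definition on_line :: "nat \<Rightarrow> nat \<Rightarrow> nat \<Rightarrow> lfm" where
  "on_line x a b = (\<^bold>\<not> \<^bold>\<not> (\<^bold>B a b x \<^bold>\<or> \<^bold>B b x a \<^bold>\<or> \<^bold>B x a b \<^bold>\<or> x \<^bold>= a \<^bold>\<or> x \<^bold>= b))"

definition collinear :: "nat \<Rightarrow> nat \<Rightarrow> nat \<Rightarrow> lfm" where
  "collinear a b c = (\<^bold>\<exists>u v. u \<^bold>\<noteq> v \<^bold>\<and> on_line a u v \<^bold>\<and> on_line b u v \<^bold>\<and> on_line c u v)"

definition seg_le :: "nat \<Rightarrow> nat \<Rightarrow> nat \<Rightarrow> nat \<Rightarrow> lfm" (\<open>_\<^bold>\<cdot>_ \<^bold>\<le> _\<^bold>\<cdot>_\<close> [60, 60, 60, 60] 50) where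
  "(a\<^bold>\<cdot>b \<^bold>\<le> c\<^bold>\<cdot>d) = (\<^bold>\<exists>e. \<^bold>T c e d \<^bold>\<and> a\<^bold>\<cdot>b \<^bold>\<cong> c\<^bold>\<cdot>e)"

text \<open>The circle with center \<open>c\<close> and radius \<open>p\<^bold>\<cdot>q\<close>, where \<open>p = q\<close> is allowed: \<open>x\<close> is on it,
  non-strictly inside it, non-strictly outside it.\<close>

definition on_circle :: "nat \<Rightarrow> nat \<Rightarrow> nat \<Rightarrow> nat \<Rightarrow> lfm" where
  "on_circle x c p q = (c\<^bold>\<cdot>x \<^bold>\<cong> p\<^bold>\<cdot>q)"

definition inside_circle :: "nat \<Rightarrow> nat \<Rightarrow> nat \<Rightarrow> nat \<Rightarrow> lfm" where
  "inside_circle x c p q = (c\<^bold>\<cdot>x \<^bold>\<le> p\<^bold>\<cdot>q)"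

definition outside_circle :: "nat \<Rightarrow> nat \<Rightarrow> nat \<Rightarrow> nat \<Rightarrow> lfm" where
  "outside_circle x c p q = (p\<^bold>\<cdot>q \<^bold>\<le> c\<^bold>\<cdot>x)"

definition stability_axioms :: "fm set" where
  "stability_axioms =
    {sentence (\<^bold>\<forall>a b. \<^bold>\<not> \<^bold>\<not> a \<^bold>= b \<^bold>\<longrightarrow> a \<^bold>= b),
     sentence (\<^bold>\<forall>a b c. \<^bold>\<not> \<^bold>\<not> \<^bold>B a b c \<^bold>\<longrightarrow> \<^bold>B a b c),
     sentence (\<^bold>\<forall>a b c d. \<^bold>\<not> \<^bold>\<not> a\<^bold>\<cdot>b \<^bold>\<cong> c\<^bold>\<cdot>d \<^bold>\<longrightarrow> a\<^bold>\<cdot>b \<^bold>\<cong> c\<^bold>\<cdot>d)}"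

definition congruence_axioms :: "fm set" where
  "congruence_axioms =
    {sentence (\<^bold>\<forall>a b. a\<^bold>\<cdot>b \<^bold>\<cong> b\<^bold>\<cdot>a),
     sentence (\<^bold>\<forall>a b p q r s. a\<^bold>\<cdot>b \<^bold>\<cong> p\<^bold>\<cdot>q \<^bold>\<and> a\<^bold>\<cdot>b \<^bold>\<cong> r\<^bold>\<cdot>s \<^bold>\<longrightarrow> p\<^bold>\<cdot>q \<^bold>\<cong> r\<^bold>\<cdot>s),
     sentence (\<^bold>\<forall>a b c. a\<^bold>\<cdot>b \<^bold>\<cong> c\<^bold>\<cdot>c \<^bold>\<longrightarrow> a \<^bold>= b)}"

definition extension_axiom :: fm where
  "extension_axiom =
    sentence (\<^bold>\<forall>a b. a \<^bold>\<noteq> b \<^bold>\<longrightarrow> (\<^bold>\<forall>c d. \<^bold>\<exists>x. \<^bold>T a b x \<^bold>\<and> b\<^bold>\<cdot>x \<^bold>\<cong> c\<^bold>\<cdot>d))"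

definition five_segment_axiom :: fm where
  "five_segment_axiom =
    sentence (\<^bold>\<forall>a b c d a' b' c' d'.
      a \<^bold>\<noteq> b \<^bold>\<and> \<^bold>T a b c \<^bold>\<and> \<^bold>T a' b' c' \<^bold>\<and>
      a\<^bold>\<cdot>b \<^bold>\<cong> a'\<^bold>\<cdot>b' \<^bold>\<and> b\<^bold>\<cdot>c \<^bold>\<cong> b'\<^bold>\<cdot>c' \<^bold>\<and> a\<^bold>\<cdot>d \<^bold>\<cong> a'\<^bold>\<cdot>d' \<^bold>\<and> b\<^bold>\<cdot>d \<^bold>\<cong> b'\<^bold>\<cdot>d'
      \<^bold>\<longrightarrow> c\<^bold>\<cdot>d \<^bold>\<cong> c'\<^bold>\<cdot>d')"

definition betweenness_axioms :: "fm set" where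
  "betweenness_axioms =
    {sentence (\<^bold>\<forall>a b c. \<^bold>B a b c \<^bold>\<longrightarrow> \<^bold>B c b a \<^bold>\<and> a \<^bold>\<noteq> b \<^bold>\<and> b \<^bold>\<noteq> c),
     sentence (\<^bold>\<forall>a b. \<^bold>\<not> \<^bold>B a b a),
     sentence (\<^bold>\<forall>a b c d. \<^bold>T a b d \<^bold>\<and> \<^bold>T b c d \<^bold>\<longrightarrow> \<^bold>T a b c \<^bold>\<and> \<^bold>T a c d),
     sentence (\<^bold>\<forall>a b c d. \<^bold>T a b c \<^bold>\<and> \<^bold>T b c d \<^bold>\<and> b \<^bold>\<noteq> c \<^bold>\<longrightarrow> \<^bold>T a c d \<^bold>\<and> \<^bold>T a b d),
     sentence (\<^bold>\<forall>a b c d. \<^bold>B a b c \<^bold>\<and> \<^bold>B a b d \<^bold>\<and> \<^bold>\<not> \<^bold>T a c d \<^bold>\<longrightarrow> \<^bold>T a d c)}"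

definition inner_Pasch_axiom :: fm where
  "inner_Pasch_axiom =
    sentence (\<^bold>\<forall>a b c p q. \<^bold>\<not> collinear a b c \<^bold>\<and> \<^bold>B a p c \<^bold>\<and> \<^bold>B b q c \<^bold>\<longrightarrow>
      (\<^bold>\<exists>x. \<^bold>B p x b \<^bold>\<and> \<^bold>B q x a))"

definition dimension_axioms :: "fm set" where
  "dimension_axioms =
    {sentence (\<^bold>\<exists>a b c. \<^bold>\<not> collinear a b c),
     sentence (\<^bold>\<forall>u v a b c. u \<^bold>\<noteq> v \<^bold>\<and> a\<^bold>\<cdot>u \<^bold>\<cong> a\<^bold>\<cdot>v \<^bold>\<and> b\<^bold>\<cdot>u \<^bold>\<cong> b\<^bold>\<cdot>v \<^bold>\<and> c\<^bold>\<cdot>u \<^bold>\<cong> c\<^bold>\<cdot>v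
       \<^bold>\<longrightarrow> collinear a b c)}"

definition line_circle_axiom :: fm where
  "line_circle_axiom =
    sentence (\<^bold>\<forall>a b c p q.
      a \<^bold>\<noteq> b \<^bold>\<and> inside_circle a c p q \<^bold>\<and> outside_circle b c p q \<^bold>\<longrightarrow>
      (\<^bold>\<exists>x. \<^bold>T a x b \<^bold>\<and> on_circle x c p q))"

definition circle_circle_axiom :: fm where
  "circle_circle_axiom =
    sentence (\<^bold>\<forall>c p q c' p' q'.
      c \<^bold>\<noteq> c' \<^bold>\<and>
      (\<^bold>\<exists>x. on_circle x c p q \<^bold>\<and> inside_circle x c' p' q') \<^bold>\<and>
      (\<^bold>\<exists>y. on_circle y c p q \<^bold>\<and> outside_circle y c' p' q') \<^bold>\<longrightarrow>
      (\<^bold>\<exists>z. on_circle z c p q \<^bold>\<and> on_circle z c' p' q'))"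

definition neutral_geometry :: "fm set" where
  "neutral_geometry =
    stability_axioms \<union> congruence_axioms \<union> betweenness_axioms \<union> dimension_axioms \<union>
    {extension_axiom, five_segment_axiom, inner_Pasch_axiom,
     line_circle_axiom, circle_circle_axiom}"

definition strong_parallel_postulate :: fm where
  "strong_parallel_postulate =
    sentence (\<^bold>\<forall>p q r s t a.
      \<^bold>B p t q \<^bold>\<and> \<^bold>B s t r \<^bold>\<and> p\<^bold>\<cdot>t \<^bold>\<cong> q\<^bold>\<cdot>t \<^bold>\<and> r\<^bold>\<cdot>t \<^bold>\<cong> s\<^bold>\<cdot>t \<^bold>\<and> p \<^bold>\<noteq> r \<^bold>\<and>
      \<^bold>\<not> on_line p s q \<^bold>\<and> \<^bold>\<not> on_line a p r \<^bold>\<longrightarrow>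
      (\<^bold>\<exists>x. on_line x s q \<^bold>\<and> on_line x p a))"

definition Euclid_5 :: fm where
  "Euclid_5 =
    sentence (\<^bold>\<forall>p q r s t a.
      \<^bold>B q a r \<^bold>\<and> \<^bold>B p t q \<^bold>\<and> \<^bold>B s t r \<^bold>\<and> p\<^bold>\<cdot>t \<^bold>\<cong> q\<^bold>\<cdot>t \<^bold>\<and> r\<^bold>\<cdot>t \<^bold>\<cong> s\<^bold>\<cdot>t \<^bold>\<and> p \<^bold>\<noteq> r \<^bold>\<and>
      \<^bold>\<not> on_line p s q \<^bold>\<longrightarrow>
      (\<^bold>\<exists>x. on_line x s q \<^bold>\<and> on_line x p a \<^bold>\<and> \<^bold>B p a x \<^bold>\<and> \<^bold>B s q x))"

end

theory Submission
  imports Defs "HOL-Library.Countable"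
begin

text \<open>The point \<open>x\<close> that Euclid 5 asks for comes from the strong parallel postulate itself: \<open>p\<close>, \<open>q\<close>, \<open>r\<close>
  are not collinear and \<open>a\<close> lies strictly between \<open>q\<close> and \<open>r\<close>, so \<open>a\<close> is off \<open>Line(p,r)\<close>, and \<open>Line(p,a)\<close>
  meets \<open>Line(s,q)\<close>. This is the only existential statement that has to be derived. What is left,
  that \<open>a\<close> is off \<open>Line(p,r)\<close> and that the intersection satisfies \<open>B(p,a,x)\<close> and \<open>B(s,q,x)\<close>, is stable:
  it is built from atoms and negations by conjunction and implication. For such statements classical reasoning is as good as intuitionistic reasoning.

  That last claim is made precise by a model construction. If a stable statement were underivable
  from its hypotheses, the hypotheses together with its negation would be consistent
  (\<open>stable_deriv\<close>). A consistent set of formulas with finitely many free variables extends to a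
  maximal consistent set with witnesses (\<open>henkin_theory_henkin\<close>). Its variables modulo provable
  equality form an ordinary classical structure, in which formulas without universal quantifiers
  are true exactly if they belong to the set (\<open>sat_iff\<close>), and in which members of the set with only
  positive universal quantifiers are true (\<open>sat_if\<close>). The restriction is genuine: a set
  that is maximal consistent intuitionistically may contain \<open>\<not>\<forall>x A\<close> together with every \<open>A(t)\<close>. But all the
  axioms have the required form, so the structure is a classical plane that satisfies the strong
  parallel postulate, and it suffices to prove the stable statement for such planes
  (\<open>transversal_between_parallels\<close>).

  The geometric argument fixes the position of \<open>x\<close> on \<open>Line(s,q)\<close>. Inner Pasch gives the point \<open>y\<close>
  where the segments \<open>pa\<close> and \<open>tr\<close> cross; it is the only common point of \<open>Line(p,a)\<close> and \<open>Line(r,s)\<close>.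
  If \<open>x\<close> is beyond \<open>q\<close>, inner Pasch applied at \<open>s\<close> shows that \<open>x\<close> is beyond \<open>a\<close>. If \<open>x\<close> is between \<open>q\<close> and
  \<open>s\<close>, a second crossing of \<open>Line(p,a)\<close> with \<open>Line(r,s)\<close> appears. The hard case is that \<open>x\<close> is beyond
  \<open>s\<close>: outer Pasch would give a point of \<open>Line(p,r)\<close> on the segment \<open>xs\<close>, against the fact that opposite
  sides of a parallelogram do not meet (\<open>parallelogram_sides_disjoint\<close>). Outer Pasch is avoided by a
  second use of the strong parallel postulate: reflect \<open>s\<close> in the midpoint \<open>m\<close> of \<open>px\<close> to get \<open>u\<close>. If
  \<open>r\<close> were off \<open>Line(p,u)\<close>, then \<open>Line(p,r)\<close> would meet \<open>Line(s,x)\<close>. So \<open>u\<close> is on \<open>Line(p,r)\<close>, and each of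
  its possible positions there is impossible.\<close>

section \<open>Renaming and structural properties of derivations\<close>

text \<open>The renaming \<open>f\<close> under one more quantifier, in the form in which \<open>ren\<close> uses it.\<close>

abbreviation up :: "(nat \<Rightarrow> nat) \<Rightarrow> nat \<Rightarrow> nat" where
  "up f \<equiv> case_nat 0 (\<lambda>n. Suc (f n))"

primrec below :: "nat \<Rightarrow> fm \<Rightarrow> bool" where
  "below k (Eq a b) = (a < k \<and> b < k)"
| "below k (Btw a b c) = (a < k \<and> b < k \<and> c < k)"
| "below k (Cng a b c d) = (a < k \<and> b < k \<and> c < k \<and> d < k)"
| "below k Bot = True"
| "below k (And p q) = (below k p \<and> below k q)"
| "below k (Or p q) = (below k p \<and> below k q)"
| "below k (Imp p q) = (below k p \<and> below k q)"
| "below k (All p) = below (Suc k) p"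
| "below k (Ex p) = below (Suc k) p"

lemma up_comp: "up f \<circ> up g = up (f \<circ> g)"
  by (auto simp: fun_eq_iff split: nat.split)

lemma ren_ren: "ren f (ren g p) = ren (f \<circ> g) p"
proof (induction p arbitrary: f g)
  case (All p) show ?case by (simp only: ren.simps All.IH up_comp)
next
  case (Ex p) show ?case by (simp only: ren.simps Ex.IH up_comp)
qed simp_all

lemma ren_cong: "below k p \<Longrightarrow> (\<And>n. n < k \<Longrightarrow> f n = g n) \<Longrightarrow> ren f p = ren g p"
proof (induction p arbitrary: f g k)
  case (And p q) then show ?case by (metis below.simps(5) ren.simps(5))
next
  case (Or p q) then show ?case by (metis below.simps(6) ren.simps(6))
next
  case (Imp p q) then show ?case by (metis below.simps(7) ren.simps(7))
next
  case (All p)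
  have "ren (up f) p = ren (up g) p"
    by (rule All.IH[of "Suc k"]) (use All.prems in \<open>auto split: nat.split\<close>)
  then show ?case by simp
next
  case (Ex p)
  have "ren (up f) p = ren (up g) p"
    by (rule Ex.IH[of "Suc k"]) (use Ex.prems in \<open>auto split: nat.split\<close>)
  then show ?case by simp
qed auto

lemma ren_ident: "ren (\<lambda>n. n) p = p"
proof -
  have "up (\<lambda>n. n) = (\<lambda>n. n)" by (auto simp: fun_eq_iff split: nat.split)
  then show ?thesis by (induction p) simp_all
qed

lemma below_mono: "below k p \<Longrightarrow> k \<le> m \<Longrightarrow> below m p"
  by (induction p arbitrary: k m) auto

lemma below_exists: "\<exists>k. below k p"
proof -
  have two: "\<exists>k. below k p \<and> below k q" if "below i p" "below j q" for i j p q
    using that below_mono[of i p "max i j"] below_mono[of j q "max i j"] by auto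
  show ?thesis
  proof (induction p)
    case (Eq a b) then show ?case by (auto intro: exI[of _ "Suc (a + b)"])
  next
    case (Btw a b c) then show ?case by (auto intro: exI[of _ "Suc (a + b + c)"])
  next
    case (Cng a b c d) then show ?case by (auto intro: exI[of _ "Suc (a + b + c + d)"])
  next
    case (All p)
    then obtain k where "below (Suc k) p" using below_mono[of _ p] by (meson le_SucI order_refl)
    then show ?case by (auto intro: exI[of _ k])
  next
    case (Ex p)
    then obtain k where "below (Suc k) p" using below_mono[of _ p] by (meson le_SucI order_refl)
    then show ?case by (auto intro: exI[of _ k])
  qed (use two in auto)
qed

definition sentences :: "fm set \<Rightarrow> bool" where "sentences \<Gamma> \<longleftrightarrow> (\<forall>p\<in>\<Gamma>. below 0 p)"

lemma ren_sentences: "sentences \<Gamma> \<Longrightarrow> ren f ` \<Gamma> = \<Gamma>"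
proof -
  assume "sentences \<Gamma>"
  then have "ren f p = p" if "p \<in> \<Gamma>" for p
    using ren_cong[of 0 p f "\<lambda>n. n"] that ren_ident unfolding sentences_def by auto
  then show ?thesis by force
qed

lemma lift_sentences: "sentences \<Gamma> \<Longrightarrow> lift ` \<Gamma> = \<Gamma>"
  unfolding lift_def by (rule ren_sentences)

text \<open>Lifting and instantiation are renamings, so both commute with renaming; this is what makes
  derivability invariant under renaming.\<close>

lemma ren_lift: "ren (up f) (lift p) = lift (ren f p)"
proof -
  have "up f \<circ> Suc = Suc \<circ> f" by auto
  then show ?thesis unfolding lift_def ren_ren by simp
qed

lemma ren_inst: "ren f (inst p t) = inst (ren (up f) p) (f t)"
proof -
  have "f \<circ> case_nat t (\<lambda>n. n) = case_nat (f t) (\<lambda>n. n) \<circ> up f"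
    by (auto simp: fun_eq_iff split: nat.split)
  then show ?thesis unfolding inst_def ren_ren by simp
qed

lemma inst_ren_up: "inst (ren (up f) p) t = ren (case_nat t f) p"
proof -
  have "case_nat t (\<lambda>n. n) \<circ> up f = case_nat t f"
    by (auto simp: fun_eq_iff split: nat.split)
  then show ?thesis unfolding inst_def ren_ren by simp
qed

lemma deriv_weaken: "\<Gamma> \<turnstile> p \<Longrightarrow> \<Gamma> \<subseteq> \<Delta> \<Longrightarrow> \<Delta> \<turnstile> p"
proof (induction arbitrary: \<Delta> rule: deriv.induct)
  case (OrE \<Gamma> p q r)
  have "\<Delta> \<turnstile> Or p q" "insert p \<Delta> \<turnstile> r" "insert q \<Delta> \<turnstile> r"
    using OrE.IH(1)[OF OrE.prems] OrE.IH(2,3)[OF insert_mono[OF OrE.prems]] by auto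
  then show ?case by (rule deriv.OrE)
next
  case (ImpI p \<Gamma> q) then show ?case by (meson deriv.ImpI insert_mono)
next
  case (AllI \<Gamma> p) then show ?case by (meson deriv.AllI image_mono)
next
  case (ExE \<Gamma> p q)
  have "\<Delta> \<turnstile> Ex p" "insert p (lift ` \<Delta>) \<turnstile> lift q"
    using ExE.IH(1)[OF ExE.prems] ExE.IH(2)[OF insert_mono[OF image_mono[OF ExE.prems]]] by auto
  then show ?case by (rule deriv.ExE)
next
  case (Assm p \<Gamma>) then show ?case by (meson deriv.Assm subsetD)
next
  case (BotE \<Gamma> p) then show ?case by (meson deriv.BotE)
next
  case (AndI \<Gamma> p q) then show ?case by (meson deriv.AndI)
next
  case (AndE1 \<Gamma> p q) then show ?case by (meson deriv.AndE1)
next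
  case (AndE2 \<Gamma> p q) then show ?case by (meson deriv.AndE2)
next
  case (OrI1 \<Gamma> p q) then show ?case by (meson deriv.OrI1)
next
  case (OrI2 \<Gamma> q p) then show ?case by (meson deriv.OrI2)
next
  case (ImpE \<Gamma> p q) then show ?case by (meson deriv.ImpE)
next
  case (AllE \<Gamma> p t) then show ?case by (meson deriv.AllE)
next
  case (ExI \<Gamma> p t) then show ?case by (meson deriv.ExI)
next
  case (EqI \<Gamma> t) then show ?case by (meson deriv.EqI)
next
  case (EqE \<Gamma> s t p) then show ?case by (meson deriv.EqE)
qed

lemma deriv_ren: "\<Gamma> \<turnstile> p \<Longrightarrow> ren f ` \<Gamma> \<turnstile> ren f p"
proof (induction arbitrary: f rule: deriv.induct)
  case (OrE \<Gamma> p q r)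
  have "ren f ` \<Gamma> \<turnstile> Or (ren f p) (ren f q)" using OrE.IH(1)[of f] by simp
  then show ?case using deriv.OrE OrE.IH(2,3)[of f] by simp
next
  case (AllI \<Gamma> p)
  have "ren (up f) ` lift ` \<Gamma> = lift ` ren f ` \<Gamma>" by (simp add: image_image ren_lift)
  then show ?case using AllI.IH[of "up f"] by (simp add: deriv.AllI)
next
  case (AllE \<Gamma> p t)
  then show ?case using deriv.AllE[of "ren f ` \<Gamma>" "ren (up f) p" "f t"] by (simp add: ren_inst)
next
  case (ExI \<Gamma> p t)
  then show ?case using deriv.ExI[of "ren f ` \<Gamma>" "ren (up f) p" "f t"] by (simp add: ren_inst)
next
  case (ExE \<Gamma> p q)
  have "ren (up f) ` lift ` \<Gamma> = lift ` ren f ` \<Gamma>" by (simp add: image_image ren_lift)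
  then have "insert (ren (up f) p) (lift ` ren f ` \<Gamma>) \<turnstile> lift (ren f q)"
    using ExE.IH(2)[of "up f"] by (simp add: ren_lift)
  then show ?case using ExE.IH(1)[of f] deriv.ExE by simp
next
  case (EqE \<Gamma> s t p)
  then show ?case using deriv.EqE[of "ren f ` \<Gamma>" "f s" "f t" "ren (up f) p"] by (simp add: ren_inst)
next
  case (AndE1 \<Gamma> p q) then show ?case using deriv.AndE1 by (metis ren.simps(5))
next
  case (AndE2 \<Gamma> p q) then show ?case using deriv.AndE2 by (metis ren.simps(5))
next
  case (ImpE \<Gamma> p q) then show ?case using deriv.ImpE by (metis ren.simps(7))
next
  case (BotE \<Gamma> p) then show ?case using deriv.BotE by (metis ren.simps(4))
next
  case (Assm p \<Gamma>) then show ?case by (simp add: deriv.Assm)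
next
  case (AndI \<Gamma> p q) then show ?case by (simp add: deriv.AndI)
next
  case (OrI1 \<Gamma> p q) then show ?case by (simp add: deriv.OrI1)
next
  case (OrI2 \<Gamma> q p) then show ?case by (simp add: deriv.OrI2)
next
  case (ImpI p \<Gamma> q) then show ?case by (simp add: deriv.ImpI)
next
  case (EqI \<Gamma> t) then show ?case by (simp add: deriv.EqI)
qed

text \<open>An assumption that is discharged by a rule is removed
  from the finite set again, and a finite set of lifted assumptions is the lift of a finite set.\<close>

lemma deriv_finite: "\<Gamma> \<turnstile> p \<Longrightarrow> \<exists>F. finite F \<and> F \<subseteq> \<Gamma> \<and> (F \<turnstile> p)"
proof (induction rule: deriv.induct)
  case (Assm p \<Gamma>)
  then have "{p} \<turnstile> p" "{p} \<subseteq> \<Gamma>" by (auto intro: deriv.Assm)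
  then show ?case by blast
next
  case (BotE \<Gamma> p) then show ?case using deriv.BotE by blast
next
  case (AndI \<Gamma> p q)
  then obtain F G where "finite F" "F \<subseteq> \<Gamma>" "F \<turnstile> p" "finite G" "G \<subseteq> \<Gamma>" "G \<turnstile> q" by blast
  then have "finite (F \<union> G)" "F \<union> G \<subseteq> \<Gamma>" "F \<union> G \<turnstile> And p q"
    by (auto intro: deriv.AndI deriv_weaken)
  then show ?case by blast
next
  case (AndE1 \<Gamma> p q) then show ?case using deriv.AndE1 by blast
next
  case (AndE2 \<Gamma> p q) then show ?case using deriv.AndE2 by blast
next
  case (OrI1 \<Gamma> p q) then show ?case using deriv.OrI1 by blast
next
  case (OrI2 \<Gamma> p q) then show ?case using deriv.OrI2 by blast
next
  case (OrE \<Gamma> p q r)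
  obtain F where F: "finite F" "F \<subseteq> \<Gamma>" "F \<turnstile> Or p q" using OrE.IH(1) by blast
  obtain G where G: "finite G" "G \<subseteq> insert p \<Gamma>" "G \<turnstile> r" using OrE.IH(2) by blast
  obtain H where H: "finite H" "H \<subseteq> insert q \<Gamma>" "H \<turnstile> r" using OrE.IH(3) by blast
  let ?K = "F \<union> (G - {p}) \<union> (H - {q})"
  have "?K \<turnstile> Or p q" by (rule deriv_weaken[OF F(3)]) blast
  moreover have "insert p ?K \<turnstile> r" by (rule deriv_weaken[OF G(3)]) blast
  moreover have "insert q ?K \<turnstile> r" by (rule deriv_weaken[OF H(3)]) blast
  ultimately have "?K \<turnstile> r" by (rule deriv.OrE)
  moreover have "finite ?K" "?K \<subseteq> \<Gamma>" using F(1,2) G(1,2) H(1,2) by auto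
  ultimately show ?case by (intro exI[of _ ?K] conjI)
next
  case (ImpI p \<Gamma> q)
  then obtain F where F: "finite F" "F \<subseteq> insert p \<Gamma>" "F \<turnstile> q" by blast
  have "insert p (F - {p}) \<turnstile> q" by (rule deriv_weaken[OF F(3)]) blast
  then have "F - {p} \<turnstile> Imp p q" by (rule deriv.ImpI)
  moreover have "finite (F - {p})" "F - {p} \<subseteq> \<Gamma>" using F(1,2) by auto
  ultimately show ?case by (intro exI[of _ "F - {p}"] conjI)
next
  case (ImpE \<Gamma> p q)
  then obtain F G where "finite F" "F \<subseteq> \<Gamma>" "F \<turnstile> Imp p q" "finite G" "G \<subseteq> \<Gamma>" "G \<turnstile> p" by blast
  then have "finite (F \<union> G)" "F \<union> G \<subseteq> \<Gamma>" "F \<union> G \<turnstile> Imp p q" "F \<union> G \<turnstile> p"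
    by (auto intro: deriv_weaken)
  then show ?case using deriv.ImpE by blast
next
  case (AllI \<Gamma> p)
  then obtain F where F: "finite F" "F \<subseteq> lift ` \<Gamma>" "F \<turnstile> p" by blast
  then obtain G where "G \<subseteq> \<Gamma>" "finite G" "F = lift ` G" by (meson finite_subset_image)
  then show ?case using F deriv.AllI by blast
next
  case (AllE \<Gamma> p t) then show ?case using deriv.AllE by blast
next
  case (ExI \<Gamma> p t) then show ?case using deriv.ExI by blast
next
  case (ExE \<Gamma> p q)
  obtain F where F: "finite F" "F \<subseteq> \<Gamma>" "F \<turnstile> Ex p" using ExE.IH(1) by blast
  obtain G where G: "finite G" "G \<subseteq> insert p (lift ` \<Gamma>)" "G \<turnstile> lift q" using ExE.IH(2) by blast
  have "G - {p} \<subseteq> lift ` \<Gamma>" "finite (G - {p})" using G by auto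
  then obtain H where H: "H \<subseteq> \<Gamma>" "finite H" "G - {p} = lift ` H" by (meson finite_subset_image)
  have "F \<union> H \<turnstile> Ex p" by (rule deriv_weaken[OF F(3)]) blast
  moreover have "insert p (lift ` (F \<union> H)) \<turnstile> lift q"
    by (rule deriv_weaken[OF G(3)]) (use H(3) in blast)
  ultimately have "F \<union> H \<turnstile> q" by (rule deriv.ExE)
  moreover have "finite (F \<union> H)" "F \<union> H \<subseteq> \<Gamma>" using F(1,2) H(1,2) by auto
  ultimately show ?case by (intro exI[of _ "F \<union> H"] conjI)
next
  case (EqI \<Gamma> t)
  have "{} \<turnstile> Eq t t" by (rule deriv.EqI)
  then show ?case by blast
next
  case (EqE \<Gamma> s t p)
  then obtain F G where "finite F" "F \<subseteq> \<Gamma>" "F \<turnstile> Eq s t" "finite G" "G \<subseteq> \<Gamma>" "G \<turnstile> inst p s" by blast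
  then have "finite (F \<union> G)" "F \<union> G \<subseteq> \<Gamma>" "F \<union> G \<turnstile> Eq s t" "F \<union> G \<turnstile> inst p s"
    by (auto intro: deriv_weaken)
  then show ?case by (intro exI[of _ "F \<union> G"] conjI) (auto intro: deriv.EqE[of _ s])
qed

text \<open>A fresh variable \<open>k\<close> may serve as a witness: renaming \<open>k\<close> to \<open>0\<close> and shifting all other variables
  turns the given derivation into the premise of the rule \<open>ExE\<close>, because a renaming is determined
  by its values on the variables that occur.\<close>

lemma witness_consistent:
  assumes "\<And>q. q \<in> insert (Ex p) \<Gamma> \<Longrightarrow> below k q" and "insert (inst p k) (insert (Ex p) \<Gamma>) \<turnstile> Bot"
  shows "insert (Ex p) \<Gamma> \<turnstile> Bot"
proof -
  \<comment> \<open>\<open>g\<close> lifts every formula over the variables below \<open>k\<close>, and sends \<open>k\<close> to the eigenvariable.\<close>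
  define g where "g n = (if n = k then 0 else Suc n)" for n
  have "ren g (inst p k) = ren (g \<circ> case_nat k (\<lambda>n. n)) p" unfolding inst_def ren_ren ..
  also have "\<dots> = ren (\<lambda>n. n) p"
    using assms(1)[of "Ex p"] by (intro ren_cong[of "Suc k"]) (auto simp: g_def split: nat.split)
  finally have p: "ren g (inst p k) = p" by (simp add: ren_ident)
  have "ren g q = lift q" if "q \<in> insert (Ex p) \<Gamma>" for q
    unfolding lift_def by (rule ren_cong[OF assms(1)[OF that]]) (simp add: g_def)
  then have "ren g ` insert (Ex p) \<Gamma> = lift ` insert (Ex p) \<Gamma>" by (rule image_cong[OF refl])
  then have "insert p (lift ` insert (Ex p) \<Gamma>) \<turnstile> Bot"
    using deriv_ren[OF assms(2), of g] p by simp
  then have "insert p (lift ` insert (Ex p) \<Gamma>) \<turnstile> lift Bot" by (simp add: lift_def)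
  moreover have "insert (Ex p) \<Gamma> \<turnstile> Ex p" by (simp add: deriv.Assm)
  ultimately show ?thesis by (rule deriv.ExE[rotated])
qed

section \<open>Maximal consistent sets with witnesses\<close>

instance fm :: countable by countable_datatype

definition bounded_variables :: "fm set \<Rightarrow> bool" where
  "bounded_variables \<Gamma> \<longleftrightarrow> (\<exists>k. \<forall>p\<in>\<Gamma>. below k p)"

lemma bounded_insert: "bounded_variables \<Gamma> \<Longrightarrow> bounded_variables (insert p \<Gamma>)"
proof -
  assume "bounded_variables \<Gamma>"
  then obtain k where k: "\<forall>q\<in>\<Gamma>. below k q" unfolding bounded_variables_def by blast
  obtain m where "below m p" using below_exists by blast
  then have "\<forall>q\<in>insert p \<Gamma>. below (max k m) q" using k below_mono[of _ _ "max k m"] by auto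
  then show "bounded_variables (insert p \<Gamma>)" unfolding bounded_variables_def by blast
qed

text \<open>Fresh variables exist at every stage of the construction because only finitely many variables
  have been used so far; this replaces the usual enlargement of the language by constants.\<close>

definition fresh :: "fm set \<Rightarrow> nat" where
  "fresh \<Gamma> = (SOME k. \<forall>p\<in>\<Gamma>. below k p)"

lemma below_fresh: "bounded_variables \<Gamma> \<Longrightarrow> p \<in> \<Gamma> \<Longrightarrow> below (fresh \<Gamma>) p"
  using someI_ex[of "\<lambda>k. \<forall>p\<in>\<Gamma>. below k p"] unfolding bounded_variables_def fresh_def by blast

fun witnessed :: "fm \<Rightarrow> fm set \<Rightarrow> fm set" where
  "witnessed (Ex p) \<Gamma> = insert (inst p (fresh (insert (Ex p) \<Gamma>))) (insert (Ex p) \<Gamma>)"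
| "witnessed p \<Gamma> = insert p \<Gamma>"

lemma insert_witnessed: "insert p \<Gamma> \<subseteq> witnessed p \<Gamma>"
  by (cases p) auto

lemma bounded_witnessed: "bounded_variables \<Gamma> \<Longrightarrow> bounded_variables (witnessed p \<Gamma>)"
  by (cases p) (simp_all add: bounded_insert)

lemma consistent_witnessed:
  assumes "bounded_variables \<Gamma>" "\<not> (insert p \<Gamma> \<turnstile> Bot)" shows "\<not> (witnessed p \<Gamma> \<turnstile> Bot)"
proof (cases p)
  case (Ex q)
  then show ?thesis
    using assms witness_consistent[of q \<Gamma> "fresh (insert p \<Gamma>)"] below_fresh[OF bounded_insert[OF assms(1)]]
    by auto
qed (use assms in simp_all)

primrec henkin_stage :: "fm set \<Rightarrow> nat \<Rightarrow> fm set" where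
  "henkin_stage \<Gamma> 0 = \<Gamma>"
| "henkin_stage \<Gamma> (Suc n) =
    (if insert (from_nat n) (henkin_stage \<Gamma> n) \<turnstile> Bot then henkin_stage \<Gamma> n
     else witnessed (from_nat n) (henkin_stage \<Gamma> n))"

definition henkin :: "fm set \<Rightarrow> fm set" where
  "henkin \<Gamma> = (\<Union>n. henkin_stage \<Gamma> n)"

lemma henkin_stage_mono: "m \<le> n \<Longrightarrow> henkin_stage \<Gamma> m \<subseteq> henkin_stage \<Gamma> n"
proof (rule lift_Suc_mono_le[of "henkin_stage \<Gamma>"])
  show "henkin_stage \<Gamma> n \<subseteq> henkin_stage \<Gamma> (Suc n)" for n
    using insert_witnessed[of "from_nat n" "henkin_stage \<Gamma> n"] by auto
qed

lemma henkin_stage_invariant: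
  assumes "bounded_variables \<Gamma>" "\<not> (\<Gamma> \<turnstile> Bot)"
  shows "bounded_variables (henkin_stage \<Gamma> n) \<and> \<not> (henkin_stage \<Gamma> n \<turnstile> Bot)"
  by (induction n) (use assms bounded_witnessed consistent_witnessed in auto)

text \<open>Maximality yields classical behaviour of the connectives, although derivability is
  intuitionistic. There is no dual condition for negated universal formulas.\<close>

locale henkin_theory =
  fixes \<Delta> :: "fm set"
  assumes consistent: "\<not> (\<Delta> \<turnstile> Bot)"
    and maximal: "p \<notin> \<Delta> \<Longrightarrow> insert p \<Delta> \<turnstile> Bot"
    and witness: "Ex p \<in> \<Delta> \<Longrightarrow> \<exists>t. inst p t \<in> \<Delta>"

lemma henkin_superset: "\<Gamma> \<subseteq> henkin \<Gamma>"
  unfolding henkin_def by (metis UN_upper UNIV_I henkin_stage.simps(1))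

text \<open>Consistency passes to the union because an inconsistency has a finite derivation, whose
  assumptions occur in one stage already.\<close>

lemma henkin_theory_henkin:
  assumes "bounded_variables \<Gamma>" "\<not> (\<Gamma> \<turnstile> Bot)" shows "henkin_theory (henkin \<Gamma>)"
proof
  show "\<not> (henkin \<Gamma> \<turnstile> Bot)"
  proof
    assume "henkin \<Gamma> \<turnstile> Bot"
    then obtain F where F: "finite F" "F \<subseteq> henkin \<Gamma>" "F \<turnstile> Bot" using deriv_finite by blast
    have "\<exists>n. F \<subseteq> henkin_stage \<Gamma> n" using F(1,2)
    proof (induction F)
      case (insert p F)
      then obtain m n where "F \<subseteq> henkin_stage \<Gamma> m" "p \<in> henkin_stage \<Gamma> n" unfolding henkin_def by auto
      then have "insert p F \<subseteq> henkin_stage \<Gamma> (max m n)"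
        using henkin_stage_mono[of m "max m n" \<Gamma>] henkin_stage_mono[of n "max m n" \<Gamma>] by auto
      then show ?case by blast
    qed simp
    then show False using henkin_stage_invariant[OF assms] deriv_weaken[OF F(3)] by blast
  qed
  have stage: "henkin_stage \<Gamma> n \<subseteq> henkin \<Gamma>" for n unfolding henkin_def by blast
  have step: "(insert p (henkin_stage \<Gamma> (to_nat p)) \<turnstile> Bot) \<or>
      witnessed p (henkin_stage \<Gamma> (to_nat p)) \<subseteq> henkin \<Gamma>" for p
    using stage[of "Suc (to_nat p)"] by (auto split: if_splits)
  show "insert p (henkin \<Gamma>) \<turnstile> Bot" if "p \<notin> henkin \<Gamma>" for p
    using step[of p] that insert_witnessed[of p] deriv_weaken[OF _ insert_mono[OF stage]] by blast
  show "\<exists>t. inst p t \<in> henkin \<Gamma>" if "Ex p \<in> henkin \<Gamma>" for p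
  proof -
    have "insert (Ex p) (henkin_stage \<Gamma> n) \<subseteq> henkin \<Gamma>" for n using stage that by blast
    then have "witnessed (Ex p) (henkin_stage \<Gamma> (to_nat (Ex p))) \<subseteq> henkin \<Gamma>"
      using step[of "Ex p"] \<open>\<not> (henkin \<Gamma> \<turnstile> Bot)\<close> deriv_weaken by blast
    then show ?thesis by auto
  qed
qed

section \<open>Classical structures and the term model\<close>

primrec holds :: "('a \<Rightarrow> 'a \<Rightarrow> 'a \<Rightarrow> bool) \<Rightarrow> ('a \<Rightarrow> 'a \<Rightarrow> 'a \<Rightarrow> 'a \<Rightarrow> bool) \<Rightarrow> (nat \<Rightarrow> 'a) \<Rightarrow> fm \<Rightarrow> bool"
where
  "holds B C e (Eq a b) \<longleftrightarrow> e a = e b"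
| "holds B C e (Btw a b c) \<longleftrightarrow> B (e a) (e b) (e c)"
| "holds B C e (Cng a b c d) \<longleftrightarrow> C (e a) (e b) (e c) (e d)"
| "holds B C e Bot \<longleftrightarrow> False"
| "holds B C e (And p q) \<longleftrightarrow> holds B C e p \<and> holds B C e q"
| "holds B C e (Or p q) \<longleftrightarrow> holds B C e p \<or> holds B C e q"
| "holds B C e (Imp p q) \<longleftrightarrow> (holds B C e p \<longrightarrow> holds B C e q)"
| "holds B C e (All p) \<longleftrightarrow> (\<forall>d. holds B C (case_nat d e) p)"
| "holds B C e (Ex p) \<longleftrightarrow> (\<exists>d. holds B C (case_nat d e) p)"

text \<open>The two fragments for which membership in a maximal consistent set controls truth in the term
  model, in both directions and in one direction. In a \<open>universal_positive\<close> formula no universal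
  quantifier occurs in the premise of an implication.\<close>

primrec universal_free :: "fm \<Rightarrow> bool" where
  "universal_free (Eq a b) = True"
| "universal_free (Btw a b c) = True"
| "universal_free (Cng a b c d) = True"
| "universal_free Bot = True"
| "universal_free (And p q) = (universal_free p \<and> universal_free q)"
| "universal_free (Or p q) = (universal_free p \<and> universal_free q)"
| "universal_free (Imp p q) = (universal_free p \<and> universal_free q)"
| "universal_free (All p) = False"
| "universal_free (Ex p) = universal_free p"

primrec universal_positive :: "fm \<Rightarrow> bool" where
  "universal_positive (Eq a b) = True"
| "universal_positive (Btw a b c) = True"
| "universal_positive (Cng a b c d) = True"
| "universal_positive Bot = True"
| "universal_positive (And p q) = (universal_positive p \<and> universal_positive q)"
| "universal_positive (Or p q) = (universal_positive p \<and> universal_positive q)"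
| "universal_positive (Imp p q) = (universal_free p \<and> universal_positive q)"
| "universal_positive (All p) = universal_positive p"
| "universal_positive (Ex p) = universal_positive p"

context henkin_theory
begin

lemma deductively_closed: "\<Delta> \<turnstile> p \<Longrightarrow> p \<in> \<Delta>"
  using consistent maximal deriv.ImpI deriv.ImpE by blast

lemma mem_Bot: "Bot \<notin> \<Delta>"
  using consistent deriv.Assm by blast

lemma mem_And: "And p q \<in> \<Delta> \<longleftrightarrow> p \<in> \<Delta> \<and> q \<in> \<Delta>"
  by (meson deductively_closed deriv.Assm deriv.AndI deriv.AndE1 deriv.AndE2)

lemma mem_Or: "Or p q \<in> \<Delta> \<longleftrightarrow> p \<in> \<Delta> \<or> q \<in> \<Delta>"
proof
  assume "Or p q \<in> \<Delta>"
  then show "p \<in> \<Delta> \<or> q \<in> \<Delta>" using consistent maximal deriv.OrE[OF deriv.Assm] by blast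
qed (meson deductively_closed deriv.Assm deriv.OrI1 deriv.OrI2)

lemma mem_Imp: "Imp p q \<in> \<Delta> \<longleftrightarrow> (p \<in> \<Delta> \<longrightarrow> q \<in> \<Delta>)"
proof
  assume "Imp p q \<in> \<Delta>"
  then show "p \<in> \<Delta> \<longrightarrow> q \<in> \<Delta>" by (meson deductively_closed deriv.Assm deriv.ImpE)
next
  assume h: "p \<in> \<Delta> \<longrightarrow> q \<in> \<Delta>"
  have "insert p \<Delta> \<turnstile> q"
    using h maximal[of p] deriv.BotE deriv.Assm[of q "insert p \<Delta>"] by blast
  then show "Imp p q \<in> \<Delta>" by (meson deductively_closed deriv.ImpI)
qed

lemma mem_All: "All p \<in> \<Delta> \<Longrightarrow> inst p t \<in> \<Delta>"
  by (meson deductively_closed deriv.Assm deriv.AllE)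

lemma mem_Ex: "Ex p \<in> \<Delta> \<longleftrightarrow> (\<exists>t. inst p t \<in> \<Delta>)"
  by (meson witness deductively_closed deriv.Assm deriv.ExI)

lemma mem_Eq_refl: "Eq t t \<in> \<Delta>"
  by (meson deductively_closed deriv.EqI)

lemma mem_Eq_subst: "Eq s t \<in> \<Delta> \<Longrightarrow> inst p s \<in> \<Delta> \<Longrightarrow> inst p t \<in> \<Delta>"
  by (meson deductively_closed deriv.Assm deriv.EqE)

text \<open>Replacement in an atom: the place that changes is variable \<open>0\<close> of the pattern, and the other
  points are shifted to make room for it.\<close>

lemma mem_Eq_sym: "Eq s t \<in> \<Delta> \<Longrightarrow> Eq t s \<in> \<Delta>"
  using mem_Eq_subst[of s t "Eq 0 (Suc s)"] mem_Eq_refl[of s] by (simp add: inst_def)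

lemma mem_Eq_trans: "Eq s t \<in> \<Delta> \<Longrightarrow> Eq t u \<in> \<Delta> \<Longrightarrow> Eq s u \<in> \<Delta>"
  using mem_Eq_subst[of t u "Eq (Suc s) 0"] by (simp add: inst_def)

lemma mem_Btw_cong:
  assumes "Eq a a' \<in> \<Delta>" "Eq b b' \<in> \<Delta>" "Eq c c' \<in> \<Delta>" "Btw a b c \<in> \<Delta>"
  shows "Btw a' b' c' \<in> \<Delta>"
  using assms mem_Eq_subst[of a a' "Btw 0 (Suc b) (Suc c)"]
    mem_Eq_subst[of b b' "Btw (Suc a') 0 (Suc c)"] mem_Eq_subst[of c c' "Btw (Suc a') (Suc b') 0"]
  by (simp add: inst_def)

lemma mem_Cng_cong:
  assumes "Eq a a' \<in> \<Delta>" "Eq b b' \<in> \<Delta>" "Eq c c' \<in> \<Delta>" "Eq d d' \<in> \<Delta>" "Cng a b c d \<in> \<Delta>"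
  shows "Cng a' b' c' d' \<in> \<Delta>"
  using assms mem_Eq_subst[of a a' "Cng 0 (Suc b) (Suc c) (Suc d)"]
    mem_Eq_subst[of b b' "Cng (Suc a') 0 (Suc c) (Suc d)"]
    mem_Eq_subst[of c c' "Cng (Suc a') (Suc b') 0 (Suc d)"]
    mem_Eq_subst[of d d' "Cng (Suc a') (Suc b') (Suc c') 0"]
  by (simp add: inst_def)

end

text \<open>Points are the variables modulo provable equality. The quotient is given abstractly by a map \<open>h\<close>,
  so that any type with the right number of elements can carry the structure.\<close>

locale term_model = henkin_theory +
  fixes h :: "nat \<Rightarrow> 'a"
  assumes surj_h: "surj h" and h_eq_iff: "h s = h t \<longleftrightarrow> Eq s t \<in> \<Delta>"
begin

definition btw_M :: "'a \<Rightarrow> 'a \<Rightarrow> 'a \<Rightarrow> bool" where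
  "btw_M x y z \<longleftrightarrow> (\<exists>a b c. x = h a \<and> y = h b \<and> z = h c \<and> Btw a b c \<in> \<Delta>)"

definition cng_M :: "'a \<Rightarrow> 'a \<Rightarrow> 'a \<Rightarrow> 'a \<Rightarrow> bool" where
  "cng_M x y z w \<longleftrightarrow> (\<exists>a b c d. x = h a \<and> y = h b \<and> z = h c \<and> w = h d \<and> Cng a b c d \<in> \<Delta>)"

abbreviation sat :: "(nat \<Rightarrow> 'a) \<Rightarrow> fm \<Rightarrow> bool" where
  "sat \<equiv> holds btw_M cng_M"

lemma btw_M_h: "btw_M (h a) (h b) (h c) \<longleftrightarrow> Btw a b c \<in> \<Delta>"
proof
  assume "btw_M (h a) (h b) (h c)"
  then obtain a' b' c' where *: "Eq a a' \<in> \<Delta>" "Eq b b' \<in> \<Delta>" "Eq c c' \<in> \<Delta>" "Btw a' b' c' \<in> \<Delta>"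
    unfolding btw_M_def h_eq_iff by blast
  show "Btw a b c \<in> \<Delta>"
    by (rule mem_Btw_cong[OF mem_Eq_sym[OF *(1)] mem_Eq_sym[OF *(2)] mem_Eq_sym[OF *(3)] *(4)])
qed (auto simp: btw_M_def)

lemma cng_M_h: "cng_M (h a) (h b) (h c) (h d) \<longleftrightarrow> Cng a b c d \<in> \<Delta>"
proof
  assume "cng_M (h a) (h b) (h c) (h d)"
  then obtain a' b' c' d' where *: "Eq a a' \<in> \<Delta>" "Eq b b' \<in> \<Delta>" "Eq c c' \<in> \<Delta>" "Eq d d' \<in> \<Delta>"
      "Cng a' b' c' d' \<in> \<Delta>"
    unfolding cng_M_def h_eq_iff by blast
  show "Cng a b c d \<in> \<Delta>"
    by (rule mem_Cng_cong[OF mem_Eq_sym[OF *(1)] mem_Eq_sym[OF *(2)] mem_Eq_sym[OF *(3)]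
          mem_Eq_sym[OF *(4)] *(5)])
qed (auto simp: cng_M_def)

lemma case_nat_h: "case_nat (h t) (h \<circ> f) = h \<circ> case_nat t f"
  by (auto simp: fun_eq_iff split: nat.split)

lemma ex_point: "(\<exists>d. P d) \<longleftrightarrow> (\<exists>t. P (h t))"
  using surj_h by (metis surjD)

text \<open>The induction runs over \<open>p\<close> for all renamings at once: the environment \<open>h \<circ> f\<close> amounts to the
  substitution \<open>f\<close>, and instantiating a bound variable extends \<open>f\<close> by one value. Every point is
  some \<open>h t\<close>, so a quantifier over points is a quantifier over terms.\<close>

lemma sat_iff: "universal_free p \<Longrightarrow> sat (h \<circ> f) p \<longleftrightarrow> ren f p \<in> \<Delta>"
proof (induction p arbitrary: f)
  case (Ex p)
  have IH: "sat (h \<circ> g) p \<longleftrightarrow> ren g p \<in> \<Delta>" for g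
    by (rule Ex.IH) (use Ex.prems in simp)
  have "sat (h \<circ> f) (Ex p) \<longleftrightarrow> (\<exists>t. sat (case_nat (h t) (h \<circ> f)) p)" unfolding holds.simps by (rule ex_point)
  also have "\<dots> \<longleftrightarrow> (\<exists>t. ren (case_nat t f) p \<in> \<Delta>)" unfolding case_nat_h IH ..
  also have "\<dots> \<longleftrightarrow> ren f (Ex p) \<in> \<Delta>" by (simp add: mem_Ex inst_ren_up)
  finally show ?case .
qed (simp_all add: h_eq_iff btw_M_h cng_M_h mem_Bot mem_And mem_Or mem_Imp)

lemma sat_all_iff: "sat e (All p) \<longleftrightarrow> (\<forall>t. sat (case_nat (h t) e) p)"
  using surj_h by (metis surjD holds.simps(8))

text \<open>For an implication, truth of the premise must give back membership, so the premise has to fall under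
  \<open>sat_iff\<close>; this is why universal quantifiers are admitted in positive positions only.\<close>

lemma sat_if: "universal_positive p \<Longrightarrow> ren f p \<in> \<Delta> \<Longrightarrow> sat (h \<circ> f) p"
proof (induction p arbitrary: f)
  case (Imp p q)
  then show ?case using sat_iff[of p f] by (auto simp: mem_Imp simp del: o_apply)
next
  case (All p)
  have "sat (case_nat (h t) (h \<circ> f)) p" for t
    unfolding case_nat_h
    by (rule All.IH) (use All.prems mem_All[of "ren (up f) p" t] in \<open>simp_all add: inst_ren_up\<close>)
  then show ?case unfolding sat_all_iff by blast
next
  case (Ex p)
  then obtain t where "ren (case_nat t f) p \<in> \<Delta>" by (auto simp: mem_Ex inst_ren_up)
  then have "sat (case_nat (h t) (h \<circ> f)) p"
    unfolding case_nat_h by (rule Ex.IH[rotated]) (use Ex.prems in simp)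
  then show ?case unfolding holds.simps by blast
qed (auto simp: h_eq_iff btw_M_h cng_M_h mem_Bot mem_And mem_Or)

end

section \<open>Formulas that admit proof by contradiction\<close>

fun stable_formula :: "fm \<Rightarrow> bool" where
  "stable_formula (Or p q) = False"
| "stable_formula (Ex p) = False"
| "stable_formula (All p) = False"
| "stable_formula (And p q) = (stable_formula p \<and> stable_formula q)"
| "stable_formula (Imp p q) = stable_formula q"
| "stable_formula p = True"

lemmas formula_defs = sentence_def all_def ex_def imp_def disj_def conj_def neg_def eq_def btw_def
  cng_def btw_T_def on_line_def collinear_def seg_le_def on_circle_def inside_circle_def
  outside_circle_def

lemmas axiom_defs = neutral_geometry_def stability_axioms_def congruence_axioms_def
  betweenness_axioms_def dimension_axioms_def extension_axiom_def five_segment_axiom_def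
  inner_Pasch_axiom_def line_circle_axiom_def circle_circle_axiom_def

lemma not_not_map:
  assumes "\<Gamma> \<turnstile> Imp (Imp p Bot) Bot" "insert p \<Gamma> \<turnstile> q" shows "\<Gamma> \<turnstile> Imp (Imp q Bot) Bot"
proof -
  let ?n = "Imp q Bot"
  have "insert p (insert ?n \<Gamma>) \<turnstile> q" by (rule deriv_weaken[OF assms(2)]) blast
  then have "insert p (insert ?n \<Gamma>) \<turnstile> Bot" by (rule deriv.ImpE[rotated]) (simp add: deriv.Assm)
  then have "insert ?n \<Gamma> \<turnstile> Imp p Bot" by (rule deriv.ImpI)
  moreover have "insert ?n \<Gamma> \<turnstile> Imp (Imp p Bot) Bot" by (rule deriv_weaken[OF assms(1)]) blast
  ultimately have "insert ?n \<Gamma> \<turnstile> Bot" by (rule deriv.ImpE[rotated])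
  then show ?thesis by (rule deriv.ImpI)
qed

text \<open>Stability of atoms is an axiom, and it is inherited by conjunctions and by implications with a
  stable conclusion. The premise of an implication can be arbitrary, so every negation is included.\<close>

lemma stable_deriv:
  assumes "stability_axioms \<subseteq> \<Gamma>" "stable_formula p" "\<Gamma> \<turnstile> Imp (Imp p Bot) Bot" shows "\<Gamma> \<turnstile> p"
  using assms
proof (induction p arbitrary: \<Gamma>)
  case (Eq a b)
  have "\<Gamma> \<turnstile> All (All (Imp (Imp (Imp (Eq 1 0) Bot) Bot) (Eq 1 0)))"
    by (rule deriv.Assm) (use Eq.prems(1) in \<open>simp add: stability_axioms_def formula_defs\<close>)
  from deriv.AllE[OF deriv.AllE[OF this, of a, unfolded inst_def ren.simps], of b]
  have "\<Gamma> \<turnstile> Imp (Imp (Imp (Eq a b) Bot) Bot) (Eq a b)" by (simp add: inst_def)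
  then show ?case using Eq.prems(3) by (rule deriv.ImpE)
next
  case (Btw a b c)
  have "\<Gamma> \<turnstile> All (All (All (Imp (Imp (Imp (Btw 2 1 0) Bot) Bot) (Btw 2 1 0))))"
    by (rule deriv.Assm) (use Btw.prems(1) in \<open>simp add: stability_axioms_def formula_defs numeral_2_eq_2\<close>)
  from deriv.AllE[OF deriv.AllE[OF deriv.AllE[OF this, of a, unfolded inst_def ren.simps],
      of b, unfolded inst_def ren.simps], of c]
  have "\<Gamma> \<turnstile> Imp (Imp (Imp (Btw a b c) Bot) Bot) (Btw a b c)" by (simp add: inst_def numeral_2_eq_2)
  then show ?case using Btw.prems(3) by (rule deriv.ImpE)
next
  case (Cng a b c d)
  have "\<Gamma> \<turnstile> All (All (All (All (Imp (Imp (Imp (Cng 3 2 1 0) Bot) Bot) (Cng 3 2 1 0)))))"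
    by (rule deriv.Assm) (use Cng.prems(1) in
      \<open>simp add: stability_axioms_def formula_defs numeral_2_eq_2 numeral_3_eq_3\<close>)
  from deriv.AllE[OF deriv.AllE[OF deriv.AllE[OF deriv.AllE[OF this, of a, unfolded inst_def ren.simps],
      of b, unfolded inst_def ren.simps], of c, unfolded inst_def ren.simps], of d]
  have "\<Gamma> \<turnstile> Imp (Imp (Imp (Cng a b c d) Bot) Bot) (Cng a b c d)"
    by (simp add: inst_def numeral_2_eq_2 numeral_3_eq_3)
  then show ?case using Cng.prems(3) by (rule deriv.ImpE)
next
  case Bot
  have "\<Gamma> \<turnstile> Imp Bot Bot" by (intro deriv.ImpI deriv.Assm) simp
  with Bot.prems(3) show ?case by (rule deriv.ImpE)
next
  case (And p q)
  let ?\<Delta> = "insert (And p q) \<Gamma>"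
  have "?\<Delta> \<turnstile> And p q" by (simp add: deriv.Assm)
  then have "?\<Delta> \<turnstile> p" "?\<Delta> \<turnstile> q" by (rule deriv.AndE1, rule deriv.AndE2)
  then have "\<Gamma> \<turnstile> Imp (Imp p Bot) Bot" "\<Gamma> \<turnstile> Imp (Imp q Bot) Bot"
    using not_not_map[OF And.prems(3)] by blast+
  then show ?case using And by (simp add: deriv.AndI)
next
  case (Imp p q)
  let ?\<Delta> = "insert p \<Gamma>"
  have "?\<Delta> \<turnstile> Imp (Imp (Imp p q) Bot) Bot" by (rule deriv_weaken[OF Imp.prems(3)]) blast
  moreover have "insert (Imp p q) ?\<Delta> \<turnstile> q"
    by (rule deriv.ImpE[of _ p]) (simp_all add: deriv.Assm)
  ultimately have "?\<Delta> \<turnstile> Imp (Imp q Bot) Bot" by (rule not_not_map)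
  then have "?\<Delta> \<turnstile> q" by (rule Imp.IH(2)[rotated 2]) (use Imp.prems(1,2) in auto)
  then show ?case by (rule deriv.ImpI)
qed simp_all

section \<open>Congruence and order in a classical plane\<close>

locale plane_relations =
  fixes B :: "'a \<Rightarrow> 'a \<Rightarrow> 'a \<Rightarrow> bool"
    and C :: "'a \<Rightarrow> 'a \<Rightarrow> 'a \<Rightarrow> 'a \<Rightarrow> bool"
begin

definition T :: "'a \<Rightarrow> 'a \<Rightarrow> 'a \<Rightarrow> bool" where
  "T a b c \<longleftrightarrow> a = b \<or> b = c \<or> B a b c"

definition col :: "'a \<Rightarrow> 'a \<Rightarrow> 'a \<Rightarrow> bool" where
  "col a b c \<longleftrightarrow> a = b \<or> b = c \<or> c = a \<or> B a b c \<or> B b c a \<or> B c a b"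

end

text \<open>The axioms for a plane, read classically, with the strong parallel postulate. The hypothesis of
  \<open>Pasch_axiom\<close> quantifies over lines, as in the formula that it comes from; \<open>inner_Pasch\<close> below is the
  version for the relation \<open>col\<close>.\<close>

locale strong_parallel_plane = plane_relations B C
  for B :: "'a \<Rightarrow> 'a \<Rightarrow> 'a \<Rightarrow> bool"
    and C :: "'a \<Rightarrow> 'a \<Rightarrow> 'a \<Rightarrow> 'a \<Rightarrow> bool" +
  assumes cong_rev: "C a b b a"
    and cong_eucl: "C a b p q \<Longrightarrow> C a b r s \<Longrightarrow> C p q r s"
    and cong_null: "C a b c c \<Longrightarrow> a = b"
    and extension: "a \<noteq> b \<Longrightarrow> \<exists>x. T a b x \<and> C b x c d"
    and five_segment: "a \<noteq> b \<Longrightarrow> T a b c \<Longrightarrow> T a' b' c' \<Longrightarrow> C a b a' b' \<Longrightarrow> C b c b' c' \<Longrightarrow>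
      C a d a' d' \<Longrightarrow> C b d b' d' \<Longrightarrow> C c d c' d'"
    and B_sym: "B a b c \<Longrightarrow> B c b a"
    and B_neq: "B a b c \<Longrightarrow> a \<noteq> b"
    and B_irrefl: "\<not> B a b a"
    and T_inner: "T a b d \<Longrightarrow> T b c d \<Longrightarrow> T a b c \<and> T a c d"
    and T_outer: "T a b c \<Longrightarrow> T b c d \<Longrightarrow> b \<noteq> c \<Longrightarrow> T a c d \<and> T a b d"
    and B_connect: "B a b c \<Longrightarrow> B a b d \<Longrightarrow> T a c d \<or> T a d c"
    and Pasch_axiom: "(\<And>u v. u \<noteq> v \<Longrightarrow> col u v a \<Longrightarrow> col u v b \<Longrightarrow> \<not> col u v c) \<Longrightarrow>
      B a p c \<Longrightarrow> B b q c \<Longrightarrow> \<exists>x. B p x b \<and> B q x a"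
    and circle_circle: "c \<noteq> c' \<Longrightarrow> C c x p q \<Longrightarrow> T p' e q' \<Longrightarrow> C c' x p' e \<Longrightarrow>
      C c y p q \<Longrightarrow> T c' f y \<Longrightarrow> C p' q' c' f \<Longrightarrow> \<exists>z. C c z p q \<and> C c' z p' q'"
    and strong_parallel: "B p t q \<Longrightarrow> B s t r \<Longrightarrow> C p t q t \<Longrightarrow> C r t s t \<Longrightarrow> p \<noteq> r \<Longrightarrow>
      \<not> col p s q \<Longrightarrow> \<not> col a p r \<Longrightarrow> \<exists>x. col x s q \<and> col x p a"
begin

lemma B_neqs: assumes "B a b c" shows "a \<noteq> b" "b \<noteq> c" "a \<noteq> c" "b \<noteq> a" "c \<noteq> b" "c \<noteq> a"
  using assms B_neq B_sym B_irrefl by metis+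

lemma B_inner: assumes "B a b d" "B b c d" shows "B a b c" "B a c d"
  using T_inner[of a b d c] assms B_neqs unfolding T_def by metis+

lemma B_outer: assumes "B a b c" "B b c d" shows "B a c d" "B a b d"
  using T_outer[of a b c d] assms B_neqs B_inner unfolding T_def by (metis B_sym)+

lemma B_antisym: "B a b c \<Longrightarrow> \<not> B b a c"
  using B_inner B_irrefl by blast

lemma B_connect': assumes "B a b c" "B a b d" "c \<noteq> d" shows "B a c d \<or> B a d c"
  using B_connect[OF assms(1,2)] assms(3) B_neqs[OF assms(1)] B_neqs[OF assms(2)] unfolding T_def by auto

lemma B_connect2: assumes "B a b c" "B a b d" "c \<noteq> d" shows "B b c d \<or> B b d c"
  using B_connect'[OF assms] assms(1,2) B_inner B_sym by blast

lemma cong_refl: "C a b a b" by (rule cong_eucl[OF cong_rev cong_rev])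
lemma cong_sym: "C a b c d \<Longrightarrow> C c d a b" by (rule cong_eucl[OF _ cong_refl])
lemma cong_trans: "C a b c d \<Longrightarrow> C c d e f \<Longrightarrow> C a b e f" by (rule cong_eucl[OF cong_sym])
lemma cong_comm1: "C a b c d \<Longrightarrow> C b a c d" by (rule cong_eucl[OF cong_rev])
lemma cong_zero: "C a a b b"
  using extension cong_null cong_refl by metis
lemma cong_neq: "C a b c d \<Longrightarrow> a \<noteq> b \<Longrightarrow> c \<noteq> d" using cong_null by blast
lemma cong_null': "C a a c d \<Longrightarrow> c = d" using cong_null cong_sym by blast

text \<open>Segments as congruence classes turn congruence into an equality that does not depend on the order
  of the endpoints, so that rewriting decides questions of transitivity and symmetry.\<close>

definition seg where "seg a b = {(c, d). C a b c d}"

lemma seg_comm: "seg a b = seg b a"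
  unfolding seg_def using cong_comm1 by blast

lemma cong_iff: "C a b c d \<longleftrightarrow> seg a b = seg c d"
proof
  assume "C a b c d" then show "seg a b = seg c d"
    unfolding seg_def using cong_eucl[of a b c d] cong_trans[of a b c d] by blast
next
  assume "seg a b = seg c d" then show "C a b c d"
    unfolding seg_def using cong_refl by blast
qed

lemma extension_B: assumes "a \<noteq> b" "c \<noteq> d" shows "\<exists>x. B a b x \<and> C b x c d"
  using extension[OF assms(1), of c d] assms cong_sym cong_null unfolding T_def by metis

lemma B_between_connect: assumes "B a b d" "B a c d" "b \<noteq> c" shows "B a b c \<or> B a c b"
proof -
  \<comment> \<open>Seen from a point beyond \<open>a\<close>, the points \<open>b\<close> and \<open>c\<close> lie on the same ray.\<close>
  obtain e where "B d a e" using extension_B B_neqs assms by metis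
  then have e: "B e a d" using B_sym by blast
  have "B e a b" "B e a c" using e assms B_sym B_inner by metis+
  then show ?thesis using B_connect2 assms(3) by blast
qed

lemma T_sym: "T a b c \<Longrightarrow> T c b a" unfolding T_def using B_sym by blast

lemma cong_add: assumes "T a b c" "T a' b' c'" "C a b a' b'" "C b c b' c'" shows "C a c a' c'"
proof (cases "a = b")
  case True then show ?thesis using assms(3,4) cong_null' by blast
next
  case False
  have "C c a c' a'"
    using five_segment[OF False assms, of a a'] assms(3) cong_zero[of a a'] by (simp add: cong_iff seg_comm)
  then show ?thesis by (simp add: cong_iff seg_comm)
qed

lemma extension_unique: assumes "a \<noteq> b" "T a b x" "T a b y" "C b x b y" shows "x = y"
  using five_segment[OF assms(1) assms(2,3) cong_refl assms(4) cong_refl cong_refl] cong_null by blast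

text \<open>Extend both outer segments beyond \<open>c\<close> and \<open>c'\<close> by equal amounts to \<open>e\<close> and \<open>e'\<close>. The five-segment
  axiom gives \<open>ed = e'd'\<close>, and a second application, going back from \<open>e\<close> through \<open>c\<close> to \<open>b\<close>, gives the claim.\<close>

lemma inner_five_segment:
  assumes "T a b c" "T a' b' c'" "C a c a' c'" "C b c b' c'" "C a d a' d'" "C c d c' d'"
  shows "C b d b' d'"
proof (cases "a = c")
  case True
  then have "a' = c'" using assms(3) cong_sym cong_null by blast
  have "b = c" "b' = c'" using True \<open>a' = c'\<close> assms(1,2) B_irrefl unfolding T_def by auto
  then show ?thesis using assms(6) by simp
next
  case False
  then have ne: "a' \<noteq> c'" using assms(3) cong_null by blast
  obtain e where e: "B a c e" "C c e a c" using extension_B[OF False False] by blast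
  obtain e' where e': "B a' c' e'" "C c' e' a c" using extension_B[OF ne False] by blast
  have ce: "C c e c' e'" using e e' by (auto simp: cong_iff seg_comm)
  have ed: "C e d e' d'"
    using five_segment[OF False _ _ assms(3) ce assms(5,6)] e(1) e'(1) unfolding T_def by blast
  have "T b c e" using e(1) assms(1) unfolding T_def using B_inner B_sym by blast
  moreover have "T b' c' e'" using e'(1) assms(2) unfolding T_def using B_inner B_sym by blast
  ultimately have "T e c b" "T e' c' b'" using T_sym by blast+
  moreover have "e \<noteq> c" using B_neqs e by blast
  moreover have "C e c e' c'" "C c b c' b'" using ce assms(4) by (auto simp: cong_iff seg_comm)
  ultimately show ?thesis using five_segment[of e c b e' c' b' d d'] ed assms(6) by blast
qed

text \<open>Lay off \<open>bc\<close> beyond \<open>b'\<close> to get \<open>c''\<close>. By the five-segment axiom a point is determined by its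
  distances from \<open>a'\<close>, \<open>b'\<close> when one such point is on the line, so \<open>c'' = c'\<close>.\<close>

lemma cong_T: assumes "T a b c" "C a b a' b'" "C b c b' c'" "C a c a' c'" shows "T a' b' c'"
proof (cases "a = b")
  case True then show ?thesis using assms(2) cong_null' unfolding T_def by blast
next
  case False
  then have ne: "a' \<noteq> b'" using assms cong_null by blast
  obtain c'' where c'': "T a' b' c''" "C b' c'' b c" using extension[OF ne] by blast
  have "C a c a' c''" using cong_add[OF assms(1) c''(1) assms(2)] c'' by (auto simp: cong_iff seg_comm)
  then have "C a' c'' a' c'" using assms by (auto simp: cong_iff seg_comm)
  moreover have "C b' c'' b' c'" using c'' assms by (auto simp: cong_iff seg_comm)
  ultimately have "C c'' c'' c'' c'"
    using five_segment[OF ne c''(1) c''(1) cong_refl cong_refl] by blast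
  then have "c'' = c'" using cong_sym cong_null by blast
  then show ?thesis using c'' by simp
qed

lemma cong_B: assumes "B a b c" "C a b a' b'" "C b c b' c'" "C a c a' c'" shows "B a' b' c'"
  using cong_T[of a b c a' b' c'] assms B_neqs[OF assms(1)] cong_neq unfolding T_def by metis

lemma col_perm: assumes "col a b c"
  shows "col a c b" "col b a c" "col b c a" "col c a b" "col c b a"
  using assms B_sym unfolding col_def by blast+

lemma B_col: assumes "B a b c"
  shows "col a b c" "col a c b" "col b a c" "col b c a" "col c a b" "col c b a"
  using assms B_sym unfolding col_def by blast+

lemma col_trivial: "col a a b" "col a b a" "col a b b" unfolding col_def by auto

lemma col_trans: assumes "a \<noteq> b" "col a b c" "col a b d" shows "col a c d"
proof (cases "c = a \<or> c = b \<or> d = a \<or> d = b \<or> c = d")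
  case True then show ?thesis using assms col_perm col_trivial by metis
next
  case False
  then have "B a b c \<or> B a c b \<or> B b a c" and "B a b d \<or> B a d b \<or> B b a d"
    using assms B_sym[of b c a] B_sym[of c a b] B_sym[of b d a] B_sym[of d a b]
    unfolding col_def by auto
  then have "B a c d \<or> B a d c \<or> B c a d"
  proof (elim disjE)
    assume "B a b c" "B a b d" then show ?thesis using B_connect'[of a b c d] False by auto
  next
    assume h: "B a b c" "B a d b" then show ?thesis using B_inner(2)[OF B_sym B_sym, OF h] B_sym by auto
  next
    assume h: "B a b c" "B b a d" then show ?thesis using B_outer(2)[OF B_sym, OF h(2,1)] B_sym by auto
  next
    assume h: "B a c b" "B a b d" then show ?thesis using B_inner(2)[OF B_sym B_sym, OF h(2,1)] B_sym by auto
  next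
    assume "B a c b" "B a d b" then show ?thesis using B_between_connect[of a c b d] False by auto
  next
    assume h: "B a c b" "B b a d" then show ?thesis using B_inner(1)[OF B_sym, OF h(2,1)] B_sym by auto
  next
    assume h: "B b a c" "B a b d" then show ?thesis using B_outer(2)[OF B_sym, OF h] B_sym by auto
  next
    assume h: "B b a c" "B a d b" then show ?thesis using B_inner(1)[OF B_sym, OF h] B_sym by auto
  next
    assume "B b a c" "B b a d" then show ?thesis using B_connect2[of b a c d] False by auto
  qed
  then show ?thesis using B_sym[of a d c] B_sym[of c a d] unfolding col_def by blast
qed

lemma col_trans3: assumes "a \<noteq> b" "col a b c" "col a b d" "col a b e" shows "col c d e"
proof (cases "a = c")
  case True
  then show ?thesis using col_trans assms by blast
next
  case False
  have "col a c d" "col a c e" using col_trans assms by blast+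
  then have "col c a d" "col c a e" using col_perm by blast+
  then show ?thesis using col_trans[OF False[symmetric]] by blast
qed

lemma inner_Pasch: "\<not> col a b c \<Longrightarrow> B a p c \<Longrightarrow> B b q c \<Longrightarrow> \<exists>x. B p x b \<and> B q x a"
  by (rule Pasch_axiom) (use col_trans3 in blast)

lemma lines_meet_once:
  assumes "\<not> col a b c" "c \<noteq> d" "col a b x" "col a b y" "col c d x" "col c d y" shows "x = y"
proof (rule ccontr)
  assume ne: "x \<noteq> y"
  have "a \<noteq> b" using assms(1) unfolding col_def by blast
  then have "col x y a" "col x y b" using assms(3,4) col_trans3[of a b] col_trivial by blast+
  moreover have "col x y c" using assms(2,5,6) col_trans3[of c d] col_trivial by blast
  ultimately show False using assms(1) ne col_trans3 by blast
qed

lemma cong_on_line: assumes "a \<noteq> b" "col a b c" "C a p a q" "C b p b q" shows "C c p c q"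
proof -
  have "T a b c \<or> T b a c \<or> T a c b" using assms(2) B_sym unfolding col_def T_def by metis
  then show ?thesis
  proof (elim disjE)
    assume "T a b c" then show ?thesis using five_segment[OF assms(1) _ _ cong_refl cong_refl assms(3,4)] by blast
  next
    assume "T b a c" then show ?thesis using five_segment[OF assms(1)[symmetric] _ _ cong_refl cong_refl assms(4,3)] by blast
  next
    assume "T a c b" then show ?thesis using inner_five_segment[OF _ _ cong_refl cong_refl assms(3,4)] by blast
  qed
qed

lemma col_on: assumes "a \<noteq> b" "col a b x" "col a b y" "x \<noteq> y" "col x y z" shows "col a b z"
proof -
  have "col x y a" "col x y b" using col_trans3[OF assms(1-3)] col_trivial by blast+
  then show ?thesis using col_trans3[OF assms(4)] assms(5) by blast
qed

lemmas B_facts = B_col B_neqs B_sym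

lemma B_extend: assumes "B a b c" "B a c d" shows "B b c d" "B a b d"
  using B_inner[OF assms(2)[THEN B_sym] assms(1)[THEN B_sym]] B_sym by auto

lemma not_col_neq: assumes "\<not> col a b c" shows "a \<noteq> b" "b \<noteq> c" "a \<noteq> c"
  using assms unfolding col_def by auto

section \<open>Triangles, parallelograms and midpoints\<close>

text \<open>With \<open>p\<close> the middle one of the three points,
  the segments \<open>xr\<close> and \<open>yw\<close> cross at \<open>z\<close> by inner Pasch. In the triangle \<open>x w y\<close>, inner Pasch then puts a
  point of \<open>Line(w,r)\<close> on the segment \<open>zx\<close>. That point can only be \<open>r\<close>, but \<open>r\<close> is outside this segment.\<close>

lemma no_line_through_three_sides:
  assumes "\<not> col w s r" "B w x s" "B s y r" "B w p r" "B x p y" shows False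
proof -
  have "\<not> col w r s" using assms(1) col_perm by blast
  then obtain z where z: "B x z r" "B y z w"
    using inner_Pasch[of w r s x y] assms(2,3) B_sym by blast
  have "\<not> col w s y"
  proof
    assume "col w s y"
    then have "col s y w" using col_perm by blast
    moreover have "col s y r" "s \<noteq> y" using B_facts[OF assms(3)] by auto
    ultimately show False using assms(1) col_trans col_perm by blast
  qed
  have wxs: "col w x s" "w \<noteq> x" using B_facts[OF assms(2)] by auto
  have "\<not> col x w y"
  proof
    assume "col x w y"
    then have "col w x y" using col_perm by blast
    then show False using \<open>\<not> col w s y\<close> wxs col_trans by blast
  qed
  then obtain u where u: "B p u w" "B z u x"
    using inner_Pasch[of x w y p z] assms(5) z(2) B_sym by blast
  have "\<not> col w r x"
  proof
    assume "col w r x"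
    then have "col w x r" using col_perm by blast
    moreover have "col w x s" "w \<noteq> x" using B_facts[OF assms(2)] by auto
    ultimately show False using assms(1) col_trans col_perm by blast
  qed
  moreover have "x \<noteq> r" using B_neqs[OF z(1)] by auto
  moreover have "col w r u"
    using col_trans3[of p w w r u] col_trivial B_facts[OF assms(4)] B_facts[OF u(1)] by blast
  moreover have "col x r u"
    using col_trans3[of z x x r u] col_trivial B_facts[OF z(1)] B_facts[OF u(2)] by blast
  ultimately have "u = r" using lines_meet_once[of w r x r u r] col_trivial by blast
  then show False using B_antisym[OF z(1)[THEN B_sym]] B_sym[OF u(2)] u(2) B_antisym[OF z(1)] by simp
qed

text \<open>The point reflection in \<open>t\<close> preserves distances. The four arms are extended beyond \<open>p\<close>, \<open>q\<close>, \<open>r\<close>, \<open>s\<close>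
  to points \<open>X\<close>, \<open>X'\<close>, \<open>Y\<close>, \<open>Y'\<close> at the common distance \<open>pt + rt\<close> from \<open>t\<close>. For these the
  five-segment axiom applies, as \<open>XY' = Y'X\<close>, and two applications of the inner version lead back to
  \<open>p\<close>, \<open>q\<close>, \<open>r\<close>, \<open>s\<close>.\<close>

lemma vertical_segments:
  assumes "B p t q" "B r t s" "C p t q t" "C r t s t" shows "C p r q s"
proof -
  have ne: "r \<noteq> t" "p \<noteq> t" "s \<noteq> t" "q \<noteq> t" using B_neqs[OF assms(1)] B_neqs[OF assms(2)] by auto
  obtain X where X: "B q p X" "C p X r t" using extension_B[of q p r t] B_neqs[OF assms(1)] ne by blast
  obtain X' where X': "B p q X'" "C q X' r t" using extension_B[of p q r t] B_neqs[OF assms(1)] ne by blast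
  obtain Y where Y: "B s r Y" "C r Y p t" using extension_B[of s r p t] B_neqs[OF assms(2)] ne by blast
  obtain Y' where Y': "B r s Y'" "C s Y' p t" using extension_B[of r s p t] B_neqs[OF assms(2)] ne by blast
  have near: "B t p X" "B t q X'" "B t r Y" "B t s Y'"
    using B_extend(1)[OF B_sym[OF assms(1)] X(1)] B_extend(1)[OF assms(1) X'(1)]
      B_extend(1)[OF B_sym[OF assms(2)] Y(1)] B_extend(1)[OF assms(2) Y'(1)] by auto
  have XX: "B X t X'"
    using B_outer(1)[OF B_sym[OF near(1)] B_outer(2)[OF assms(1) near(2)]] .
  have YY: "B Y' t Y"
    using B_outer(1)[OF B_sym[OF near(4)] B_outer(2)[OF B_sym[OF assms(2)] near(3)]] .
  note eqs = assms(3,4) X(2) X'(2) Y(2) Y'(2)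
  have 1: "C t X t X'" using cong_add[of t p X t q X'] near eqs unfolding T_def by (auto simp: cong_iff seg_comm)
  have 2: "C t Y t Y'" using cong_add[of t r Y t s Y'] near eqs unfolding T_def by (auto simp: cong_iff seg_comm)
  have 3: "C t X Y t" using cong_add[of t p X Y r t] near near[THEN B_sym] eqs unfolding T_def by (auto simp: cong_iff seg_comm)
  note lens = 1 2 3
  have "C X' Y' Y X"
    using five_segment[of X t X' Y' t Y Y' X] XX YY B_neqs[OF XX] lens unfolding T_def
    by (auto simp: cong_iff seg_comm)
  then have "C r X s X'"
    using inner_five_segment[of Y r t Y' s t X X'] near near[THEN B_sym] lens eqs unfolding T_def
    by (auto simp: cong_iff seg_comm)
  then show ?thesis
    using inner_five_segment[of X p t X' q t r s] near near[THEN B_sym] lens eqs unfolding T_def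
    by (auto simp: cong_iff seg_comm)
qed

lemma cong_col: assumes "col a b c" "C a b a' b'" "C b c b' c'" "C c a c' a'" shows "col a' b' c'"
proof -
  have "C a c a' c'" "C b a b' a'" "C c b c' b'" using assms(2-4) by (auto simp: cong_iff seg_comm)
  then show ?thesis using assms(1) cong_B assms(2-4) cong_null' unfolding col_def by metis
qed

text \<open>A common point \<open>w\<close> of the opposite sides is reflected in the center \<open>t\<close>. The reflection exchanges the two
  lines, so the image is a second common point, and the lines coincide.\<close>

lemma parallelogram_sides_disjoint:
  assumes "B p t q" "B s t r" "C p t q t" "C r t s t" "p \<noteq> r" "\<not> col p s q" "col w p r"
  shows "\<not> col w s q"
proof
  assume w: "col w s q"
  have "w \<noteq> t"
  proof
    assume "w = t"
    then have "col q t s" using w col_perm by blast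
    moreover have "col q t p" "q \<noteq> t" using B_facts[OF assms(1)] by auto
    ultimately show False using assms(6) col_trans3[of q t p s q] col_trivial by blast
  qed
  then obtain w' where w': "B w t w'" "C t w' w t" using extension_B[of w t w t] by blast
  have r: "B r t s" "C w t w' t" using assms(2) B_sym w' by (auto simp: cong_iff seg_comm)
  have 1: "C w p w' q" using vertical_segments[OF w'(1) assms(1) r(2) assms(3)] .
  have 2: "C w r w' s" using vertical_segments[OF w'(1) r(1) r(2) assms(4)] .
  have 3: "C w s w' r" using vertical_segments[OF w'(1) assms(2) r(2)] assms(4) cong_sym by blast
  have 4: "C w q w' p" using vertical_segments[OF w'(1) B_sym[OF assms(1)] r(2)] assms(3) cong_sym by blast
  have 5: "C p r q s" using vertical_segments[OF assms(1) r(1) assms(3,4)] .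
  have 6: "C s q r p" using 5 by (auto simp: cong_iff seg_comm)
  have "col w' q s" using cong_col[OF assms(7) 1 5] 2 by (auto simp: cong_iff seg_comm)
  moreover have "col w' r p" using cong_col[OF w 3 6] 4 by (auto simp: cong_iff seg_comm)
  moreover have "w \<noteq> w'" using B_neqs[OF w'(1)] by auto
  moreover have "s \<noteq> q" using not_col_neq[OF assms(6)] by simp
  moreover have "col p r w" using assms(7) col_perm by blast
  moreover have "col s q w" using w col_perm by blast
  ultimately have "col s q p"
    using col_on[of s q w w' p] col_trans3[OF assms(5), of w w' p]
      col_perm[of w' q s] col_perm[of w' r p] col_trivial by auto
  then show False using assms(6) col_perm by blast
qed

lemma part_not_cong: assumes "B a b c" shows "\<not> C a b a c"
proof
  assume eq: "C a b a c"
  obtain e where "B c a e" using extension_B[of c a a b] B_neqs[OF assms] by blast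
  then have e: "B e a c" by (rule B_sym)
  then have "B e a b" using B_inner(1)[OF e assms] by simp
  then show False using e extension_unique[of e a b c] eq B_neqs[OF assms] B_neqs[OF e] unfolding T_def by auto
qed

text \<open>Of two circles, each centered at \<open>a\<close> or \<open>b\<close> and passing through the other point, the first contains \<open>b\<close>,
  the center of the second, and the point opposite to \<open>b\<close>, which is outside the second; so they meet. A
  collinear intersection would give a segment congruent to a proper part of itself.\<close>

lemma equilateral: assumes "a \<noteq> b" shows "\<exists>c. \<not> col a b c \<and> C c a c b"
proof -
  obtain y where y: "B b a y" "C a y a b" using extension_B[of b a a b] assms by blast
  obtain c where c: "C a c a b" "C b c b a"
    using circle_circle[of a b b a b b b a y a] assms y cong_refl unfolding T_def by blast
  have "c \<noteq> a" "c \<noteq> b" using c assms cong_null' by blast+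
  moreover have "\<not> B a b c" using part_not_cong c(1) cong_sym by blast
  moreover have "\<not> B a c b" using part_not_cong c(1) cong_sym by blast
  moreover have "\<not> B b a c" using part_not_cong c(2) cong_sym by blast
  ultimately have "\<not> col a b c" using assms B_sym[of c a b] B_sym[of b c a] unfolding col_def by blast
  moreover have "C c a c b" using c by (auto simp: cong_iff seg_comm)
  ultimately show ?thesis by blast
qed

lemma copy_inner_point: assumes "B a b c" "C a c a' c'"
  shows "\<exists>b'. B a' b' c' \<and> C a b a' b' \<and> C b c b' c'"
proof -
  have ne: "a' \<noteq> c'" "a \<noteq> b" "b \<noteq> c" using B_neqs[OF assms(1)] cong_neq[OF assms(2)] by auto
  obtain e where e: "B c' a' e" using extension_B[of c' a' a b] ne by blast
  then have ea: "e \<noteq> a'" "B e a' c'" using B_facts[OF e] by auto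
  obtain b' where b': "B e a' b'" "C a' b' a b" using extension_B[OF ea(1) ne(2)] by blast
  have "a' \<noteq> b'" using B_neqs[OF b'(1)] by auto
  then obtain d where d: "B a' b' d" "C b' d b c" using extension_B[of a' b' b c] ne(3) by blast
  have "C a c a' d" using cong_add[of a b c a' b' d] assms(1) d b' unfolding T_def
    by (auto simp: cong_iff seg_comm)
  then have "C a' d a' c'" using assms(2) by (auto simp: cong_iff seg_comm)
  moreover have "B e a' d" using B_outer(2)[OF b'(1) d(1)] .
  ultimately have "d = c'" using extension_unique[OF ea(1), of d c'] ea(2) unfolding T_def by blast
  then show ?thesis using d b' cong_sym by blast
qed

text \<open>Erect an equilateral triangle \<open>abc\<close> and prolong its legs equally to \<open>p\<close> and \<open>q\<close>. The diagonals \<open>aq\<close> and \<open>bp\<close> of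
  the resulting trapezium cross at a point \<open>r\<close> that is equidistant from \<open>a\<close> and \<open>b\<close>, because the mirror
  image \<open>r'\<close> of \<open>r\<close> is on both diagonals as well. So all of \<open>Line(c,r)\<close> is equidistant from \<open>a\<close> and \<open>b\<close>, and inner
  Pasch lets it cross the segment \<open>ab\<close>.\<close>

lemma midpoint_exists: assumes "a \<noteq> b" shows "\<exists>m. B a m b \<and> C a m b m"
proof -
  obtain c where c: "\<not> col a b c" "C c a c b" using equilateral[OF assms] by blast
  have ne: "c \<noteq> a" "c \<noteq> b" using c not_col_neq by blast+
  obtain p where p: "B c a p" "C a p a b" using extension_B[of c a a b] ne assms by blast
  obtain q where q: "B c b q" "C b q a b" using extension_B[of c b a b] ne assms by blast
  have pb: "\<not> col c b p" using c(1) p(1) B_col(2) B_neqs[OF p(1)] col_trans[of c p b a] col_perm by metis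
  have "\<not> col p q c" using pb q(1) B_col(2) B_neqs[OF q(1)] col_trans[of c q p b] col_perm by metis
  then obtain r where r: "B a r q" "B b r p"
    using inner_Pasch[of p q c a b] p(1) q(1) B_sym by blast
  have apbq: "C a p b q" using p q by (auto simp: cong_iff seg_comm)
  have cpq: "C c p c q" using cong_add[of c a p c b q] p q c(2) apbq unfolding T_def by blast
  have diag: "C p b q a"
    using five_segment[of c a p c b q b a] ne p q c(2) apbq unfolding T_def by (auto simp: cong_iff seg_comm)
  obtain r' where r': "B a r' q" "C b r a r'" "C r p r' q"
    using copy_inner_point[OF r(2), of a q] diag by (auto simp: cong_iff seg_comm)
  have "C r a r' b"
    using inner_five_segment[of b r p a r' q a b] r(2) r' diag apbq unfolding T_def
    by (auto simp: cong_iff seg_comm)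
  have "C r q r' p"
    using inner_five_segment[of b r p a r' q q p] r(2) r' diag apbq q p unfolding T_def
    by (auto simp: cong_iff seg_comm)
  have "B b r' p" using cong_B[OF r(1), of b r' p] \<open>C r a r' b\<close> \<open>C r q r' p\<close> diag by (auto simp: cong_iff seg_comm)
  have "\<not> col b p a" using pb col_trans[of p a b c] B_facts[OF p(1)] col_perm by metis
  then have "r = r'" using lines_meet_once[of b p a q r r'] r r' \<open>B b r' p\<close> B_col B_neqs[OF r(1)] by blast
  then have ra: "C r a r b" using \<open>C r a r' b\<close> by simp
  obtain m where m: "B a m b" "B r m c"
    using inner_Pasch[of c b p a r] pb p(1) r(2) by blast
  have "C m a m b" using cong_on_line[of r c m a b] ra c(2) m(2) B_col B_neqs[OF m(2)] by blast
  then show ?thesis using m by (auto simp: cong_iff seg_comm)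
qed

section \<open>A transversal between parallels\<close>

lemma not_col_perm: assumes "\<not> col a b c"
  shows "\<not> col a c b" "\<not> col b a c" "\<not> col b c a" "\<not> col c a b" "\<not> col c b a"
  using assms col_perm by blast+

lemma not_col_shift: assumes "\<not> col a b c" "col a b d" "a \<noteq> d" shows "\<not> col a d c"
  using assms col_trans[of a d b c] col_perm(1) by blast

text \<open>The classical content of Euclid 5: the intersection of \<open>Line(p,a)\<close> with \<open>Line(s,q)\<close>, if there is one, is on
  the expected side. The proof eliminates the positions of \<open>x\<close> between \<open>q\<close> and \<open>s\<close> and beyond \<open>s\<close>.\<close>

lemma transversal_between_parallels:
  assumes a: "B q a r" and ptq: "B p t q" and str: "B s t r" and mid: "C p t q t" "C r t s t"
    and ne: "p \<noteq> r" and nc: "\<not> col p s q"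
  shows "\<not> col a p r" and "col x s q \<Longrightarrow> col x p a \<Longrightarrow> B p a x \<and> B s q x"
proof -
  note nqps = not_col_perm[OF nc] nc

  have "\<not> col q t s" using not_col_shift[of q p s t] nqps B_facts[OF ptq] by blast
  note nqts = not_col_perm[OF this] this
  have "\<not> col p t s" using not_col_shift[of p q s t] nqps B_facts[OF ptq] by blast
  note npts = not_col_perm[OF this] this
  have "\<not> col s r q" using not_col_shift[of s t q r] nqts B_facts[OF str] by blast
  note nsrq = not_col_perm[OF this] this
  have "\<not> col s r p" using not_col_shift[of s t p r] npts B_facts[OF str] by blast
  note nsrp = not_col_perm[OF this] this
  have "\<not> col r t q" using not_col_shift[of r s q t] nsrq B_facts[OF str] by blast
  note nrtq = not_col_perm[OF this] this
  have "\<not> col q p r" using not_col_shift[of q t r p] nrtq B_facts[OF ptq] by blast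
  note nqpr = not_col_perm[OF this] this
  have "\<not> col r a p" using not_col_shift[of r q p a] nqpr B_facts[OF a] by blast
  note nrap = not_col_perm[OF this] this
  have "\<not> col q a p" using not_col_shift[of q r p a] nqpr B_facts[OF a] by blast
  note nqap = not_col_perm[OF this] this
  have "\<not> col q a s" using not_col_shift[of q r s a] nsrq B_facts[OF a] by blast
  note nqas = not_col_perm[OF this] this
  show "\<not> col a p r" using nrap by blast
  assume x: "col x s q" "col x p a"
  obtain y where y: "B t y r" "B a y p"
    using inner_Pasch[of p r q t a] nqpr ptq B_sym[OF a] by blast
  have yrs: "B r y s" "B y t s" using B_extend[OF B_sym[OF y(1)] B_sym[OF str]] by auto
  have meet: "z = y" if "col p a z" "col r s z" for z
    using lines_meet_once[of p a r s z y] that nrap B_facts[OF str] B_facts[OF y(2)] B_facts[OF yrs(1)] by blast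
  have pax: "col p a x" using x col_perm by blast
  have sqx: "col s q x" using x col_perm by blast
  have pa: "p \<noteq> a" using not_col_neq[OF nrap(1)] by blast
  have sq: "s \<noteq> q" using not_col_neq[OF nc] by blast
  have xq: "x \<noteq> q" using x(2) nqap by blast
  have xs: "x \<noteq> s" using meet[of s] pax col_trivial B_neqs[OF yrs(1)] by blast
  have xa: "x \<noteq> a" using x(1) nqas by blast
  have xp: "x \<noteq> p" using x(1) nc by blast
  have "\<not> col s x r" using not_col_shift[of s q r x] nsrq sqx xs by blast
  note nsxr = not_col_perm[OF this] this
  have "\<not> col q x r" using not_col_shift[of q s r x] nsrq sqx[THEN col_perm(2)] xq by blast
  note nqxr = not_col_perm[OF this] this
  have "\<not> col q x p" using not_col_shift[of q s p x] nqps sqx[THEN col_perm(2)] xq by blast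
  note nqxp = not_col_perm[OF this] this
  have "\<not> col s x p" using not_col_shift[of s q p x] nqps sqx xs by blast
  note nsxp = not_col_perm[OF this] this
  have pay: "col p a y" using B_facts[OF y(2)] by blast
  consider "B s q x" | "B q x s" | "B x s q"
    using x(1) sq xq xs unfolding col_def by blast
  then show "B p a x \<and> B s q x"
  proof cases
    case 1
    \<comment> \<open>\<open>Line(p,a)\<close> crosses \<open>qr\<close> between \<open>y\<close> and \<open>x\<close>, and it can only do so at \<open>a\<close>.\<close>
    obtain z where z: "B q z r" "B y z x"
      using inner_Pasch[of x r s q y] nsxr B_sym[OF 1] yrs(1) by blast
    have "col p a z" using col_on[OF pa pay pax] B_facts[OF z(2)] by blast
    then have "z = a"
      using lines_meet_once[of p a q r z a] nqap B_facts[OF z(1)] B_facts[OF a] col_trivial by blast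
    then have "B p a x" using B_outer(1)[OF B_sym[OF y(2)]] z(2) by blast
    then show ?thesis using 1 by blast
  next
    case 2
    \<comment> \<open>\<open>Line(p,a)\<close> would meet \<open>Line(r,s)\<close> on both sides of \<open>t\<close>.\<close>
    obtain z where z: "B t z s" "B x z p"
      using inner_Pasch[of p s q t x] nc ptq B_sym[OF 2] by blast
    have "col p a z" using col_on[OF pa pax, of p z] xp col_trivial B_facts[OF z(2)] by blast
    moreover have "col r s z"
      using col_on[of r s t s z] B_facts[OF str] B_facts[OF z(1)] col_trivial by blast
    ultimately have "z = y" using meet by blast
    then show ?thesis using B_antisym[OF z(1)] yrs(2) by blast
  next
    case 3
    \<comment> \<open>Now \<open>y\<close> is between \<open>a\<close> and \<open>x\<close> as well, so \<open>x\<close> and \<open>p\<close> are on the same ray from \<open>y\<close>.\<close>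
    obtain z where z: "B a z x" "B s z r"
      using inner_Pasch[of r x q a s] nqxr B_sym[OF a] 3 by blast
    have "col p a z" using col_on[OF pa pax, of a z] xa col_trivial B_facts[OF z(1)] by blast
    then have "z = y" using meet B_facts[OF z(2)] by blast
    then have "B y p x \<or> B y x p" using B_connect2[OF y(2)] z(1) xp by blast
    then show ?thesis
    proof
      assume yxp: "B y x p"
      \<comment> \<open>\<open>Line(t,x)\<close> would cross all sides of the triangle \<open>s y p\<close>.\<close>
      obtain z where z: "B t z x" "B s z p"
        using inner_Pasch[of p x q t s] nqxp ptq 3 by blast
      have "\<not> col s y p" using not_col_shift[of s r p y] nsrp B_facts[OF yrs(1)] by blast
      then show ?thesis
        using no_line_through_three_sides[of s y p t x z] B_sym[OF yrs(2)] yxp z by blast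
    next
      assume ypx: "B y p x"
      \<comment> \<open>The parallel to \<open>Line(s,x)\<close> through \<open>p\<close> is constructed a second time, now as \<open>Line(p,u)\<close>.\<close>
      obtain m where m: "B p m x" "C p m x m" using midpoint_exists[of p x] xp by blast
      have ypm: "B y p m" using B_inner(1)[OF ypx m(1)] .
      have "\<not> col p m s" using not_col_shift[of p x s m] nsxp B_facts[OF m(1)] by blast
      note npms = not_col_perm[OF this] this
      obtain u where u: "B s m u" "C m u m s" using extension_B[of s m m s] not_col_neq[OF npms(1)] by blast
      have um: "C u m s m" using u(2) by (simp add: cong_iff seg_comm)
      have pu: "p \<noteq> u" using B_facts[OF u(1)] npms by blast
      have pam: "col p a m" using col_on[OF pa pax, of p m] xp col_trivial B_facts[OF m(1)] by blast
      have "col r p u"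
      proof (rule ccontr)
        assume "\<not> col r p u"
        then obtain w where w: "col w s x" "col w p r"
          using strong_parallel[OF m(1) u(1) m(2) um pu] nsxp by blast
        have "col s q w" using col_on[OF sq sqx, of s w] xs col_trivial w(1) col_perm by blast
        then show False
          using parallelogram_sides_disjoint[OF ptq str mid ne nc w(2)] col_perm by blast
      qed
      then have ru: "col p r u" using col_perm by blast
      have "\<not> col p u s" using not_col_shift[OF _ ru pu] nsrp by blast
      note npus = not_col_perm[OF this] this
      consider "r = u" | "B u p r" | "B p r u" | "B p u r"
        using ru ne pu B_sym[of r u p] B_sym[of r p u] unfolding col_def by blast
      \<comment> \<open>The point \<open>p\<close> is strictly between \<open>y\<close> and \<open>m\<close>. If it is between \<open>u\<close> and \<open>r\<close>, then \<open>Line(m,y)\<close> crosses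
        all sides of the triangle \<open>u s r\<close>; otherwise \<open>Line(p,a)\<close> has two crossings with \<open>Line(r,s)\<close> or
        with \<open>Line(s,u)\<close>.\<close>
      then show ?thesis
      proof cases
        case 1
        then have "m = y" using meet[OF pam] B_facts[OF u(1)] by blast
        then show ?thesis using B_neqs[OF ypm] by blast
      next
        case 2
        have "\<not> col r u s" using not_col_shift[of r p s u] nsrp B_facts[OF 2] by blast
        then have "\<not> col u s r" using not_col_perm by blast
        then show ?thesis
          using no_line_through_three_sides[of u s r m y p] B_sym[OF u(1)] B_sym[OF yrs(1)] 2 B_sym[OF ypm]
          by blast
      next
        case 3
        obtain z where z: "B r z s" "B m z p"
          using inner_Pasch[of p s u r m] npus 3 u(1) by blast
        have "col p a z" using col_on[OF pa pam, of p z] B_facts[OF z(2)] col_trivial by blast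
        then have "z = y" using meet B_facts[OF z(1)] by blast
        then show ?thesis using B_antisym[OF z(2)[THEN B_sym]] B_sym[OF ypm] ypm B_antisym[OF z(2)] B_antisym[OF ypm] by blast
      next
        case 4
        obtain z where z: "B u z s" "B y z p"
          using inner_Pasch[of p s r u y] nsrp 4 B_sym[OF yrs(1)] by blast
        have "col p y z" "col p y m" "p \<noteq> y" using B_facts[OF z(2)] B_facts[OF ypm] by auto
        then have "col p m z" "col p m m" using col_trans[of p y m z] col_trivial by blast+
        then have "z = m"
          using lines_meet_once[of p m s u z m] npms B_facts[OF z(1)] B_facts[OF u(1)] by blast
        then show ?thesis using z(2) B_antisym[OF B_sym[OF ypm]] B_sym[OF z(2)] by blast
      qed
    qed
  qed
qed

end

section \<open>From the classical plane back to derivations\<close>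

abbreviation parallel_geometry :: "fm set" where
  "parallel_geometry \<equiv> insert strong_parallel_postulate neutral_geometry"

lemma sentences_parallel_geometry: "sentences parallel_geometry"
  by (simp add: sentences_def axiom_defs strong_parallel_postulate_def formula_defs)

lemma universal_positive_parallel_geometry: "p \<in> parallel_geometry \<Longrightarrow> universal_positive p"
  by (auto simp: axiom_defs strong_parallel_postulate_def formula_defs)

lemma strong_parallel_plane_of_model:
  fixes e :: "nat \<Rightarrow> 'a"
  assumes model: "\<And>p. p \<in> parallel_geometry \<Longrightarrow> holds B C e p"
  shows "strong_parallel_plane B C"
proof -
  interpret plane_relations B C .
  show ?thesis
  proof
    have "\<forall>p\<in>congruence_axioms. holds B C e p"
      using model by (simp add: neutral_geometry_def)
    note cng = this[unfolded congruence_axioms_def formula_defs, simplified]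
    show "C a b b a" for a b
      using cng by blast
    show "C p q r s" if "C a b p q" "C a b r s" for a b p q r s
      using cng that by meson
    show "a = b" if "C a b c c" for a b c
      using cng that by meson
    show "\<exists>x. T a b x \<and> C b x c d" if "a \<noteq> b" for a b c d
    proof -
      have "holds B C e extension_axiom" by (rule model) (simp add: neutral_geometry_def)
      from this[unfolded extension_axiom_def formula_defs, simplified] that
      show ?thesis unfolding T_def by blast
    qed
    show "C c d c' d'" if "a \<noteq> b" "T a b c" "T a' b' c'" "C a b a' b'" "C b c b' c'"
      "C a d a' d'" "C b d b' d'" for a b c d a' b' c' d'
    proof -
      have "holds B C e five_segment_axiom" by (rule model) (simp add: neutral_geometry_def)
      from this[unfolded five_segment_axiom_def formula_defs, simplified, folded T_def,
          rule_format, of a b c a' b' c' d d'] that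
      show ?thesis by simp
    qed
    have "\<forall>p\<in>betweenness_axioms. holds B C e p"
      using model by (simp add: neutral_geometry_def)
    note btw = this[unfolded betweenness_axioms_def formula_defs, simplified, folded T_def]
    note btw1 = btw[THEN conjunct1, rule_format]
      and btw2 = btw[THEN conjunct2, THEN conjunct1, rule_format]
      and btw3 = btw[THEN conjunct2, THEN conjunct2, THEN conjunct1, rule_format]
      and btw4 = btw[THEN conjunct2, THEN conjunct2, THEN conjunct2, THEN conjunct1, rule_format]
      and btw5 = btw[THEN conjunct2, THEN conjunct2, THEN conjunct2, THEN conjunct2, rule_format]
    show "B c b a" if "B a b c" for a b c
      using btw1[OF that] by simp
    show "a \<noteq> b" if "B a b c" for a b c
      using btw1[OF that] by simp
    show "\<not> B a b a" for a b
      by (rule btw2)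
    show "T a b c \<and> T a c d" if "T a b d" "T b c d" for a b c d
      using btw3[of a b d c] that by simp
    show "T a c d \<and> T a b d" if "T a b c" "T b c d" "b \<noteq> c" for a b c d
      using btw4[of a b c d] that by simp
    show "T a c d \<or> T a d c" if "B a b c" "B a b d" for a b c d
      using btw5[of a b c d] that unfolding T_def by blast
    show "\<exists>x. B p x b \<and> B q x a"
      if "\<And>u v. u \<noteq> v \<Longrightarrow> col u v a \<Longrightarrow> col u v b \<Longrightarrow> \<not> col u v c" "B a p c" "B b q c" for a b c p q
    proof -
      have "holds B C e inner_Pasch_axiom" by (rule model) (simp add: neutral_geometry_def)
      note Pasch = this[unfolded inner_Pasch_axiom_def formula_defs, simplified,
          THEN spec, THEN spec, THEN spec, THEN spec, THEN spec, THEN mp, OF conjI[OF _ conjI], of a b c p q]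
      show ?thesis by (rule Pasch) (use that in \<open>unfold col_def, blast+\<close>)
    qed
    show "\<exists>z. C c z p q \<and> C c' z p' q'"
      if "c \<noteq> c'" "C c x p q" "T p' f q'" "C c' x p' f" "C c y p q" "T c' g y" "C p' q' c' g"
      for c c' x p q p' f q' y g
    proof -
      have "holds B C e circle_circle_axiom" by (rule model) (simp add: neutral_geometry_def)
      from this[unfolded circle_circle_axiom_def formula_defs, simplified, folded T_def,
          THEN spec, THEN spec, THEN spec, THEN spec, THEN spec, THEN spec, THEN mp, of c c' p q p' q'] that
      show ?thesis by blast
    qed
    show "\<exists>x. col x s q \<and> col x p a"
      if "B p t q" "B s t r" "C p t q t" "C r t s t" "p \<noteq> r" "\<not> col p s q" "\<not> col a p r" for p q r s t a
    proof -
      have "holds B C e strong_parallel_postulate" by (rule model) simp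
      from this[unfolded strong_parallel_postulate_def formula_defs, simplified,
          THEN spec, THEN spec, THEN spec, THEN spec, THEN spec, THEN spec, THEN mp, of p t q s r a] that
      show ?thesis unfolding col_def by blast
    qed
  qed
qed

text \<open>The hypotheses of Euclid 5 for the points at the given de Bruijn levels, and the stable
  statement that is derived from them by contradiction.\<close>

definition configuration :: "nat \<Rightarrow> nat \<Rightarrow> nat \<Rightarrow> nat \<Rightarrow> nat \<Rightarrow> nat \<Rightarrow> lfm" where
  "configuration p q r s t a =
    (\<^bold>B q a r \<^bold>\<and> \<^bold>B p t q \<^bold>\<and> \<^bold>B s t r \<^bold>\<and> p\<^bold>\<cdot>t \<^bold>\<cong> q\<^bold>\<cdot>t \<^bold>\<and> r\<^bold>\<cdot>t \<^bold>\<cong> s\<^bold>\<cdot>t \<^bold>\<and> p \<^bold>\<noteq> r \<^bold>\<and> \<^bold>\<not> on_line p s q)"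

definition conclusion :: "nat \<Rightarrow> nat \<Rightarrow> nat \<Rightarrow> nat \<Rightarrow> nat \<Rightarrow> nat \<Rightarrow> nat \<Rightarrow> lfm" where
  "conclusion p q r s t a x =
    (\<^bold>\<not> on_line a p r \<^bold>\<and> (on_line x s q \<^bold>\<and> on_line x p a \<^bold>\<longrightarrow> \<^bold>B p a x \<^bold>\<and> \<^bold>B s q x))"

text \<open>Under seven quantifiers, for \<open>p\<close>, \<open>q\<close>, \<open>r\<close>, \<open>s\<close>, \<open>t\<close>, \<open>a\<close> and \<open>x\<close> in this order, the levels \<open>0\<close> to \<open>6\<close> become
  the free variables \<open>6\<close> to \<open>0\<close>.\<close>

definition open_configuration where "open_configuration = configuration 0 1 2 3 4 5 7"
definition open_conclusion where "open_conclusion = conclusion 0 1 2 3 4 5 6 7"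

text \<open>The set whose inconsistency makes the conclusion derivable from the configuration. It is a closed
  term, so the quotient of the variables for it can be made a type: the geometric lemmas speak about all elements of a type and apply to it directly. The set of classes
  is never empty, whether or not the counterexample is consistent.\<close>

definition counterexample :: "fm set" where
  "counterexample = insert (Imp open_conclusion Bot) (insert open_configuration parallel_geometry)"

definition point_class :: "nat \<Rightarrow> nat set" where
  "point_class t = {s. Eq s t \<in> henkin counterexample}"

typedef point = "range point_class" by blast

definition pt :: "nat \<Rightarrow> point" where "pt t = Abs_point (point_class t)"

lemma surj_pt: "surj pt"
proof -
  have "\<exists>t. x = pt t" for x
    by (cases x) (auto simp: pt_def)
  then show ?thesis unfolding surj_def by blast
qed

text \<open>\<open>on_line x s q\<close> is collinearity only if \<open>s\<close> and \<open>q\<close> differ. They do: otherwise \<open>p\<close> and \<open>r\<close> would both be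
  the point opposite to \<open>q\<close> at the same distance from \<open>t\<close>.\<close>

lemma (in strong_parallel_plane) configuration_conclusion:
  assumes "holds B C e open_configuration" shows "holds B C e open_conclusion"
proof -
  define p q r s t a x where "p = e 6" "q = e 5" "r = e 4" "s = e 3" "t = e 2" "a = e 1" "x = e 0"
  note points = this
  note H = assms[unfolded open_configuration_def configuration_def formula_defs, simplified, folded points]
  have B: "B q a r" "B p t q" "B s t r" and C: "C p t q t" "C r t s t" and pr: "p \<noteq> r"
    using H by (auto simp: points)
  have "s \<noteq> q"
  proof
    assume "s = q"
    then have "B q t r" "C t p t r" using B(3) C by (auto simp: cong_iff seg_comm)
    then show False
      using extension_unique[of q t p r] B_sym[OF B(2)] B_neqs[OF B(2)] pr unfolding T_def by auto
  qed
  then have nc: "\<not> col p s q" using H B_neqs[OF B(2)] unfolding col_def by blast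
  note ray = transversal_between_parallels[OF B C pr nc]
  have "\<not> (B p r a \<or> B r a p \<or> B a p r \<or> a = p \<or> a = r)"
    using ray(1) unfolding col_def by blast
  moreover have "B s q x \<or> B q x s \<or> B x s q \<or> x = s \<or> x = q \<Longrightarrow>
      B p a x \<or> B a x p \<or> B x p a \<or> x = p \<or> x = a \<Longrightarrow> B p a x \<and> B s q x"
    using ray(2)[of x] unfolding col_def by blast
  ultimately show ?thesis
    by (auto simp: open_conclusion_def conclusion_def formula_defs points)
qed

lemma counterexample_inconsistent: "counterexample \<turnstile> Bot"
proof (rule ccontr)
  assume cons: "\<not> (counterexample \<turnstile> Bot)"
  have "bounded_variables parallel_geometry"
    using sentences_parallel_geometry unfolding bounded_variables_def sentences_def by blast
  then have "bounded_variables counterexample" by (simp add: counterexample_def bounded_insert)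
  then interpret henkin_theory "henkin counterexample"
    using cons by (rule henkin_theory_henkin)
  interpret term_model "henkin counterexample" pt
  proof
    show "surj pt" by (rule surj_pt)
    have "point_class s = point_class t \<longleftrightarrow> Eq s t \<in> henkin counterexample" for s t
      unfolding point_class_def using mem_Eq_refl mem_Eq_sym mem_Eq_trans by blast
    then show "pt s = pt t \<longleftrightarrow> Eq s t \<in> henkin counterexample" for s t
      by (simp add: pt_def Abs_point_inject[OF rangeI rangeI])
  qed
  have mem: "parallel_geometry \<subseteq> henkin counterexample" "open_configuration \<in> henkin counterexample"
      "Imp open_conclusion Bot \<in> henkin counterexample"
    using henkin_superset[of counterexample] unfolding counterexample_def by blast+
  have true: "sat pt p" if "p \<in> henkin counterexample" "universal_positive p" for p
    using sat_if[of p "\<lambda>n. n"] that by (simp add: ren_ident o_def)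
  interpret strong_parallel_plane btw_M cng_M
  proof (rule strong_parallel_plane_of_model[of _ _ pt])
    fix p assume p: "p \<in> parallel_geometry"
    then show "sat pt p" using true universal_positive_parallel_geometry mem(1) by blast
  qed
  have "sat pt open_configuration"
    by (rule true[OF mem(2)]) (simp add: open_configuration_def configuration_def formula_defs)
  moreover have "sat pt (Imp open_conclusion Bot)"
    by (rule true[OF mem(3)]) (simp add: open_conclusion_def conclusion_def formula_defs)
  ultimately show False using configuration_conclusion by simp
qed

text \<open>The renaming \<open>f\<close> makes the result available in contexts with different numberings of the points.\<close>

lemma conclusion_derivable: "insert (ren f open_configuration) parallel_geometry \<turnstile> ren f open_conclusion"
proof -
  let ?\<Gamma> = "insert open_configuration parallel_geometry"
  have "?\<Gamma> \<turnstile> Imp (Imp open_conclusion Bot) Bot"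
    by (rule deriv.ImpI) (use counterexample_inconsistent in \<open>simp add: counterexample_def\<close>)
  moreover have "stability_axioms \<subseteq> ?\<Gamma>" unfolding neutral_geometry_def by blast
  moreover have "stable_formula open_conclusion" by (simp add: open_conclusion_def conclusion_def formula_defs)
  ultimately have "?\<Gamma> \<turnstile> open_conclusion" by (rule stable_deriv[rotated 2])
  from deriv_ren[OF this, of f] show ?thesis
    using ren_sentences[OF sentences_parallel_geometry] by simp
qed

lemma deriv_And_iff: "(\<Gamma> \<turnstile> And p q) \<longleftrightarrow> (\<Gamma> \<turnstile> p) \<and> (\<Gamma> \<turnstile> q)"
  using deriv.AndI deriv.AndE1 deriv.AndE2 by blast

text \<open>Over a set of sentences, a formula and its universal generalization are derivable from each
  other, without changing the numbering of the variables.\<close>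

lemma AllI_sentences: "sentences \<Gamma> \<Longrightarrow> \<Gamma> \<turnstile> p \<Longrightarrow> \<Gamma> \<turnstile> All p"
  by (rule deriv.AllI) (simp add: lift_sentences)

lemma ren_shift: "ren (case_nat 0 Suc) p = p"
proof -
  have "case_nat 0 Suc = (\<lambda>n. n)" by (auto simp: fun_eq_iff split: nat.split)
  then show ?thesis by (simp add: ren_ident)
qed

lemma AllE_sentences: assumes "sentences \<Gamma>" "\<Gamma> \<turnstile> All p" shows "\<Gamma> \<turnstile> p"
proof -
  have "\<Gamma> \<turnstile> All (ren (up Suc) p)" using deriv_ren[OF assms(2), of Suc] ren_sentences[OF assms(1)] by simp
  from deriv.AllE[OF this, of 0] show ?thesis by (simp add: inst_ren_up ren_shift)
qed

lemma lift_ExI: assumes "\<Gamma> \<turnstile> p" shows "\<Gamma> \<turnstile> lift (Ex p)"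
  using deriv.ExI[of \<Gamma> "ren (up Suc) p" 0] assms by (simp add: lift_def inst_ren_up ren_shift)

theorem theorem6p13:
  shows "neutral_geometry \<turnstile> Imp strong_parallel_postulate Euclid_5"
proof (rule deriv.ImpI)
  let ?\<Gamma> = parallel_geometry
  define H6 where "H6 = configuration 0 1 2 3 4 5 6"
  define X7 where "X7 = (on_line 6 3 1 \<^bold>\<and> on_line 6 0 5) 7"
  define J where "J = (on_line 6 3 1 \<^bold>\<and> on_line 6 0 5 \<^bold>\<and> \<^bold>B 0 5 6 \<^bold>\<and> \<^bold>B 3 1 6) 7"
  define A6 where "A6 = (\<^bold>B 0 4 1 \<^bold>\<and> \<^bold>B 3 4 2 \<^bold>\<and> 0\<^bold>\<cdot>4 \<^bold>\<cong> 1\<^bold>\<cdot>4 \<^bold>\<and> 2\<^bold>\<cdot>4 \<^bold>\<cong> 3\<^bold>\<cdot>4 \<^bold>\<and> 0 \<^bold>\<noteq> 2 \<^bold>\<and>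
      \<^bold>\<not> on_line 0 3 1 \<^bold>\<and> \<^bold>\<not> on_line 5 0 2) 6"
  note sents = sentences_parallel_geometry
  note gen = AllE_sentences[OF sents]
  \<comment> \<open>The suffix of a name is the quantifier depth of the formula: at depth \<open>6\<close> the points \<open>p\<close> to \<open>a\<close> are
    variables, at depth \<open>7\<close> also the intersection \<open>x\<close>, which has level \<open>6\<close>.\<close>
  have E5: "Euclid_5 = All (All (All (All (All (All (Imp H6 (Ex J)))))))"
    by (simp add: Euclid_5_def H6_def J_def configuration_def formula_defs)
  have SP: "strong_parallel_postulate = All (All (All (All (All (All (Imp A6 (Ex X7)))))))"
    by (simp add: strong_parallel_postulate_def A6_def X7_def formula_defs)
  have H6: "insert H6 ?\<Gamma> \<turnstile> H6" by (simp add: deriv.Assm)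
  \<comment> \<open>Here \<open>x\<close> does not exist yet; the renaming identifies it with \<open>a\<close>, which is harmless because only
    the first conjunct of the conclusion is needed.\<close>
  have "ren (\<lambda>n. n - 1) open_configuration = H6"
    by (simp add: H6_def open_configuration_def configuration_def formula_defs)
  then have "insert H6 ?\<Gamma> \<turnstile> ren (\<lambda>n. n - 1) open_conclusion"
    using conclusion_derivable[of "\<lambda>n. n - 1"] by simp
  moreover obtain D where "ren (\<lambda>n. n - 1) open_conclusion = And ((\<^bold>\<not> on_line 5 0 2) 6) D"
    by (simp add: open_conclusion_def conclusion_def formula_defs)
  ultimately have "insert H6 ?\<Gamma> \<turnstile> (\<^bold>\<not> on_line 5 0 2) 6" by (simp add: deriv_And_iff)
  then have A6: "insert H6 ?\<Gamma> \<turnstile> A6"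
    using H6 by (simp add: H6_def A6_def configuration_def conj_def deriv_And_iff)
  have "?\<Gamma> \<turnstile> All (All (All (All (All (All (Imp A6 (Ex X7)))))))"
    by (rule deriv.Assm) (simp flip: SP)
  note this[THEN gen, THEN gen, THEN gen, THEN gen, THEN gen, THEN gen]
  then have "insert H6 ?\<Gamma> \<turnstile> Imp A6 (Ex X7)" by (rule deriv_weaken) blast
  then have ex: "insert H6 ?\<Gamma> \<turnstile> Ex X7" using A6 by (rule deriv.ImpE)
  have "lift H6 = open_configuration"
    by (simp add: lift_def H6_def open_configuration_def configuration_def formula_defs)
  then have ctx: "lift ` insert H6 ?\<Gamma> = insert open_configuration ?\<Gamma>"
    unfolding image_insert[of lift H6] lift_sentences[OF sents] by simp
  have parts: "open_conclusion =
      And ((\<^bold>\<not> on_line 5 0 2) 7) (Imp X7 ((\<^bold>B 0 5 6 \<^bold>\<and> \<^bold>B 3 1 6) 7))"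
    by (simp add: open_conclusion_def X7_def conclusion_def conj_def imp_def)
  have "insert X7 (insert open_configuration ?\<Gamma>) \<turnstile> open_conclusion"
    by (rule deriv_weaken[OF conclusion_derivable[of "\<lambda>n. n", unfolded ren_ident]]) blast
  then have "insert X7 (insert open_configuration ?\<Gamma>) \<turnstile> Imp X7 ((\<^bold>B 0 5 6 \<^bold>\<and> \<^bold>B 3 1 6) 7)"
    unfolding parts by (rule deriv.AndE2)
  moreover have X7: "insert X7 (insert open_configuration ?\<Gamma>) \<turnstile> X7" by (simp add: deriv.Assm)
  ultimately have "insert X7 (insert open_configuration ?\<Gamma>) \<turnstile> (\<^bold>B 0 5 6 \<^bold>\<and> \<^bold>B 3 1 6) 7"
    by (rule deriv.ImpE)
  then have "insert X7 (insert open_configuration ?\<Gamma>) \<turnstile> J"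
    using X7 unfolding X7_def J_def conj_def deriv_And_iff by blast
  then have "insert X7 (lift ` insert H6 ?\<Gamma>) \<turnstile> lift (Ex J)" unfolding ctx by (rule lift_ExI)
  with ex have "insert H6 ?\<Gamma> \<turnstile> Ex J" by (rule deriv.ExE)
  then have "?\<Gamma> \<turnstile> Imp H6 (Ex J)" by (rule deriv.ImpI)
  then show "?\<Gamma> \<turnstile> Euclid_5" unfolding E5 by (intro AllI_sentences[OF sents])
qed

end
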